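(* Let $\mathcal{F}=(S,\mathcal{I})$ be the combination of independence systems $(S_j,\mathcal{I}_j)$, $j\in[M]$, where each $(S_j,\mathcal{I}_j)$ is a $k_j$-growth system, and let $w:S\to\mathbb{R}_{\ge0}$ be injective. Let $k=\max_{e\in S}\sum_{j:\,e\in S_j}k_j$, and let $Y=Y(p)$ be a random set containing each element of $S$ independently with probability $p\in[0,1]$. Then, for $p=\sqrt{1-1/(k+1)}$, $$\mathbb{E}\big[w(\mathrm{Core}(\mathrm{Rel}(Y)))\big]\ \ge\ \Big(2+\frac1k-2\sqrt{1+\frac1k}\Big)\,w(\mathrm{OPT}(S)),\qquad\text{where}\quad 2+\frac1k-2\sqrt{1+\frac1k}\;>\;\frac{1}{4k^2}-\frac{1}{8k^3}.$$ Furthermore, if all components are matroids (i.e. $\mathcal{F}$ is a $k$-matchoid, with all $k_j=1$), setting $p=0$ for $k=1$ and $p=1-1/(2k)$ for $k\ge2$ yields $$\mathbb{E}\big[w(\mathrm{Core}(\mathrm{Rel}(Y)))\big]\ \ge\ \begin{cases} w(\mathrm{OPT}(S)) & \text{if }k=1,\\ \frac{1}{4k^2}\,w(\mathrm{OPT}(S)) & \text{if }k\ge2.\end{cases}$$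
   Context: An independence system $(S,\mathcal{I})$ is a finite set $S$ with a nonempty downward-closed family $\mathcal{I}\subseteq 2^S$ of independent sets; circuits are minimal non-independent sets; a basis of $X\subseteq S$ is a maximal independent subset of $X$. Write $X+e=X\cup\{e\}$ and $w(X)=\sum_{x\in X}w(x)$. $\mathrm{OPT}(S)$ is a maximum-weight independent set (basis) of $S$ in $\mathcal{F}$. Combination: the combination of $(S_j,\mathcal{I}_j)$, $j\in[M]$, is $(S,\mathcal{I})$ with $S=\bigcup_j S_j$ and $\mathcal{I}=\{I\subseteq S: I\cap S_j\in\mathcal{I}_j\ \forall j\}$. $k$-growth system ($k$ a positive integer): for all $X\subseteq S$ and all $I\in\mathcal{I}$ there is a partition $(Q,Z)$ of $I\setminus X$ with $|Z|\le k|X\setminus I|$ such that $P\cup Q\in\mathcal{I}$ for every basis $P$ of $X$. (The 1-growth systems are exactly matroids.) Primitive hull of component $j$: for $X\subseteq S_j$, $\mathrm{PHull}_j(X)=X\cup\{e\in S_j: e \text{ belongs to some circuit of }(S_j,\mathcal{I}_j)\text{ contained in }X+e\}$. Primitive core: $\mathrm{PCore}_j(X)=\{e\in X: e\notin\mathrm{PHull}_j(\{f\in X:w(f)>w(e)\})\}$. Core: for $X\subseteq S$, $\mathrm{Core}(X)=\bigcap_{j=1}^M\big((X\setminus S_j)\cup\mathrm{PCore}_j(X\cap S_j)\big)$. $\mathrm{Greedy}(X)$: process the elements of $X$ in decreasing order of $w$, starting from $\emptyset$, adding an element whenever the current set stays in $\mathcal{I}$; $\mathrm{Greedy}(X)$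 is the final set. $\mathrm{Rel}(Y)=\{y\in S\setminus Y: y\in\mathrm{Greedy}(Y+y)\}$. *)

theory Defs
  imports "HOL-Probability.Probability"
begin

definition indep_system :: "'a set \<Rightarrow> 'a set set \<Rightarrow> bool" where
  "indep_system S \<I> \<longleftrightarrow>
     finite S \<and> \<I> \<noteq> {} \<and> \<I> \<subseteq> Pow S \<and> (\<forall>I\<in>\<I>. \<forall>J. J \<subseteq> I \<longrightarrow> J \<in> \<I>)"

definition circuit :: "'a set \<Rightarrow> 'a set set \<Rightarrow> 'a set \<Rightarrow> bool" where
  "circuit S \<I> C \<longleftrightarrow> C \<subseteq> S \<and> C \<notin> \<I> \<and> (\<forall>D. D \<subset> C \<longrightarrow> D \<in> \<I>)"

definition basis_of :: "'a set set \<Rightarrow> 'a set \<Rightarrow> 'a set \<Rightarrow> bool" where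
  "basis_of \<I> X B \<longleftrightarrow> B \<in> \<I> \<and> B \<subseteq> X \<and> (\<forall>J\<in>\<I>. B \<subseteq> J \<and> J \<subseteq> X \<longrightarrow> J = B)"

definition matroid :: "'a set \<Rightarrow> 'a set set \<Rightarrow> bool" where
  "matroid S \<I> \<longleftrightarrow>
     indep_system S \<I> \<and>
     (\<forall>I\<in>\<I>. \<forall>J\<in>\<I>. card I < card J \<longrightarrow> (\<exists>e\<in>J - I. insert e I \<in> \<I>))"

text \<open>The pair \<open>(Q, Z)\<close> is chosen before the basis \<open>P\<close>; either part may be empty.\<close>

definition growth_system :: "nat \<Rightarrow> 'a set \<Rightarrow> 'a set set \<Rightarrow> bool" where
  "growth_system k S \<I> \<longleftrightarrow>
     0 < k \<and> indep_system S \<I> \<and>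
     (\<forall>X I. X \<subseteq> S \<and> I \<in> \<I> \<longrightarrow>
        (\<exists>Q Z. Q \<union> Z = I - X \<and> Q \<inter> Z = {} \<and> card Z \<le> k * card (X - I) \<and>
               (\<forall>P. basis_of \<I> X P \<longrightarrow> P \<union> Q \<in> \<I>)))"

text \<open>
  The components are indexed by \<open>j \<in> {1..M}\<close>, component \<open>j\<close> being \<open>(Sj j, Ij j)\<close>; the sets
  \<open>Sj j\<close> may overlap.
\<close>

definition comb_ground :: "nat \<Rightarrow> (nat \<Rightarrow> 'a set) \<Rightarrow> 'a set" where
  "comb_ground M Sj = (\<Union>j\<in>{1..M}. Sj j)"

definition comb_indep :: "nat \<Rightarrow> (nat \<Rightarrow> 'a set) \<Rightarrow> (nat \<Rightarrow> 'a set set) \<Rightarrow> 'a set set" where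
  "comb_indep M Sj Ij = {I. I \<subseteq> comb_ground M Sj \<and> (\<forall>j\<in>{1..M}. I \<inter> Sj j \<in> Ij j)}"

text \<open>Meaningful only for a nonempty ground set, as \<open>Max {}\<close> is unspecified.\<close>

definition comb_param :: "nat \<Rightarrow> (nat \<Rightarrow> 'a set) \<Rightarrow> (nat \<Rightarrow> nat) \<Rightarrow> nat" where
  "comb_param M Sj \<kappa> = (MAX e\<in>comb_ground M Sj. \<Sum>j | j \<in> {1..M} \<and> e \<in> Sj j. \<kappa> j)"

definition primitive_hull :: "'a set \<Rightarrow> 'a set set \<Rightarrow> 'a set \<Rightarrow> 'a set" where
  "primitive_hull S \<I> X =
     X \<union> {e \<in> S. \<exists>C. circuit S \<I> C \<and> e \<in> C \<and> C \<subseteq> insert e X}"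

definition primitive_core :: "('a \<Rightarrow> real) \<Rightarrow> 'a set \<Rightarrow> 'a set set \<Rightarrow> 'a set \<Rightarrow> 'a set" where
  "primitive_core w S \<I> X = {e \<in> X. e \<notin> primitive_hull S \<I> {f \<in> X. w f > w e}}"

definition core :: "('a \<Rightarrow> real) \<Rightarrow> nat \<Rightarrow> (nat \<Rightarrow> 'a set) \<Rightarrow> (nat \<Rightarrow> 'a set set) \<Rightarrow> 'a set \<Rightarrow> 'a set"
  where
  "core w M Sj Ij X = (\<Inter>j\<in>{1..M}. (X - Sj j) \<union> primitive_core w (Sj j) (Ij j) (X \<inter> Sj j))"

text \<open>
  The sort key \<open>- w\<close> gives decreasing order of weight. The enumeration is only meaningful for
  finite \<open>X\<close> on which \<open>w\<close> is injective.
\<close>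

definition greedy :: "('a \<Rightarrow> real) \<Rightarrow> 'a set set \<Rightarrow> 'a set \<Rightarrow> 'a set" where
  "greedy w \<I> X =
     fold (\<lambda>e I. if insert e I \<in> \<I> then insert e I else I)
       (sorted_key_list_of_set (\<lambda>x. - w x) X) {}"

definition rel :: "('a \<Rightarrow> real) \<Rightarrow> 'a set \<Rightarrow> 'a set set \<Rightarrow> 'a set \<Rightarrow> 'a set" where
  "rel w S \<I> Y = {y \<in> S - Y. y \<in> greedy w \<I> (insert y Y)}"

definition max_weight_indep :: "('a \<Rightarrow> real) \<Rightarrow> 'a set set \<Rightarrow> 'a set \<Rightarrow> bool" where
  "max_weight_indep w \<I> = is_arg_max (sum w) (\<lambda>I. I \<in> \<I>)"

text \<open>Each element of \<open>S\<close> is included independently with probability \<open>p\<close>, for \<open>0 \<le> p \<le> 1\<close>.\<close>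

definition random_subset :: "'a set \<Rightarrow> real \<Rightarrow> 'a set pmf" where
  "random_subset S p = map_pmf (\<lambda>f. {e \<in> S. f e}) (Pi_pmf S False (\<lambda>_. bernoulli_pmf p))"

definition expected_core_weight ::
    "('a \<Rightarrow> real) \<Rightarrow> nat \<Rightarrow> (nat \<Rightarrow> 'a set) \<Rightarrow> (nat \<Rightarrow> 'a set set) \<Rightarrow> real \<Rightarrow> real" where
  "expected_core_weight w M Sj Ij p =
     measure_pmf.expectation (random_subset (comb_ground M Sj) p)
       (\<lambda>Y. sum w (core w M Sj Ij (rel w (comb_ground M Sj) (comb_indep M Sj Ij) Y)))"

end

theory Submission
  imports Defs
begin

text \<open>
  Call \<open>e\<close> a candidate for \<open>Y\<close> if the greedy solution built from the elements of \<open>Y\<close> heavier than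
  \<open>e\<close> can be extended by \<open>e\<close>. This depends only on the heavier part of \<open>Y\<close>, so a candidate joins
  \<open>Greedy(Y)\<close> with probability \<open>p\<close> and \<open>Rel(Y)\<close> with probability \<open>1 - p\<close>. Hence
  \<open>E[w(Rel(Y))] \<ge> (1 - p) / k \<cdot> w(OPT)\<close>, since \<open>Greedy(Y)\<close> is within a factor \<open>k\<close> of \<open>w(OPT \<inter> Y)\<close>.

  Whether a candidate \<open>e\<close> lies in the primitive hull, in component \<open>j\<close>, of the heavier elements of
  \<open>Rel(Y)\<close> again does not depend on the coin of \<open>e\<close>. If it does and \<open>e\<close> is in \<open>Rel(Y)\<close>, then
  component \<open>j\<close> discards \<open>e\<close> from the core. The same candidates landing in \<open>Y\<close> form an independent
  set in the hull of \<open>Rel(Y)\<close>, hence have at most \<open>k\<^sub>j\<close> times the weight of \<open>Rel(Y) \<inter> S\<^sub>j\<close>, because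
  the part \<open>Q\<close> of the growth property must avoid the hull; in a matroid they even weigh at most as
  much as the primitive core. Comparing both coin outcomes, component \<open>j\<close> discards in expectation
  at most a \<open>k\<^sub>j (1 - p) / p\<close> fraction of the weight of \<open>Rel(Y) \<inter> S\<^sub>j\<close>, respectively \<open>1 - p\<close> for
  matroids. For \<open>k = 1\<close> the components are disjoint, and already \<open>Y = {}\<close> gives a core weighing at
  least as much as every independent set.
\<close>

section \<open>Comparing weights level by level\<close>

text \<open>Layer-cake argument: lower all weights by their minimum \<open>m\<close>. The constant
  layer compares \<open>sum f S\<close> with \<open>sum g S\<close>, and the remaining weights
  vanish at the minimum, which leaves a proper subset for the induction.\<close>

lemma weighted_sum_mono_levels:
  fixes w f g :: "'a \<Rightarrow> real"
  assumes "finite S" and "\<And>e. e \<in> S \<Longrightarrow> 0 \<le> w e"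
    and "\<And>t. sum f {e \<in> S. t \<le> w e} \<le> sum g {e \<in> S. t \<le> w e}"
  shows "(\<Sum>e\<in>S. w e * f e) \<le> (\<Sum>e\<in>S. w e * g e)"
  using assms
proof (induction S arbitrary: w rule: finite_psubset_induct)
  case (psubset S)
  show ?case
  proof (cases "S = {}")
    case False
    define m where "m = Min (w ` S)"
    define S' where "S' = {e \<in> S. w e \<noteq> m}"
    have m_le: "m \<le> w e" if "e \<in> S" for e
      using that psubset.hyps by (simp add: m_def)
    have "m \<in> w ` S"
      unfolding m_def using psubset.hyps False by (intro Min_in) auto
    then have "0 \<le> m" and "S' \<subset> S"
      using psubset.prems(1) by (auto simp: S'_def)
    have "sum f {e \<in> S'. t \<le> w e - m} \<le> sum g {e \<in> S'. t \<le> w e - m}" for t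
    \<comment> \<open>For \<open>t \<le> 0\<close> the level is all of \<open>S'\<close>, whereas
      the threshold \<open>t + m\<close> would also admit the removed elements. The matching
      threshold for \<open>w\<close> is then the smallest weight on \<open>S'\<close>.\<close>
    proof (cases "t \<le> 0")
      case True
      then have "{e \<in> S'. t \<le> w e - m} = {e \<in> S. Min (w ` S') \<le> w e}" if "S' \<noteq> {}"
      proof -
        have "finite S'" using psubset.hyps by (simp add: S'_def)
        then have "Min (w ` S') \<in> w ` S'" using that by (intro Min_in) auto
        then have "m < Min (w ` S')" using m_le by (force simp: S'_def)
        then show ?thesis
          using True m_le \<open>finite S'\<close> by (force simp: S'_def)
      qed
      then show ?thesis
        using psubset.prems(2) by (cases "S' = {}") auto
    next
      case False
      then have "{e \<in> S'. t \<le> w e - m} = {e \<in> S. t + m \<le> w e}"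
        by (auto simp: S'_def)
      then show ?thesis
        using psubset.prems(2) by simp
    qed
    then have "(\<Sum>e\<in>S'. (w e - m) * f e) \<le> (\<Sum>e\<in>S'. (w e - m) * g e)"
      using m_le by (intro psubset.IH[OF \<open>S' \<subset> S\<close>]) (auto simp: S'_def)
    also have "(\<Sum>e\<in>S'. (w e - m) * h e) = (\<Sum>e\<in>S. (w e - m) * h e)" for h
      using psubset.hyps by (intro sum.mono_neutral_left) (auto simp: S'_def)
    finally have "(\<Sum>e\<in>S. (w e - m) * f e) \<le> (\<Sum>e\<in>S. (w e - m) * g e)"
      using \<open>\<And>h. (\<Sum>e\<in>S'. (w e - m) * h e) = (\<Sum>e\<in>S. (w e - m) * h e)\<close> by simp
    moreover have "{e \<in> S. m \<le> w e} = S"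
      using m_le by auto
    then have "m * sum f S \<le> m * sum g S"
      using psubset.prems(2)[of m] \<open>0 \<le> m\<close> by (simp add: mult_left_mono)
    ultimately show ?thesis
      by (simp add: left_diff_distrib sum_subtractf sum_distrib_left)
  qed simp
qed

text \<open>Use the indicator of \<open>A\<close> and \<open>c\<close> times the indicator of
  \<open>B\<close> as coefficients; their sums over a level are the two sides of the cardinality
  bound.\<close>

lemma sum_le_if_card_levels_le:
  fixes w :: "'a \<Rightarrow> real"
  assumes fin: "finite A" "finite B" and nonneg: "\<And>e. e \<in> A \<union> B \<Longrightarrow> 0 \<le> w e"
    and "\<And>t. card {e \<in> A. t \<le> w e} \<le> c * card {e \<in> B. t \<le> w e}"
  shows "sum w A \<le> real c * sum w B"
proof -
  have ind: "sum (\<lambda>e. of_bool (e \<in> D)) {e \<in> A \<union> B. t \<le> w e} = real (card {e \<in> D. t \<le> w e})"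
    if "D \<subseteq> A \<union> B" for D t
  proof -
    have "sum (\<lambda>e. of_bool (e \<in> D)) {e \<in> A \<union> B. t \<le> w e} = sum (\<lambda>_. 1::real) {e \<in> D. t \<le> w e}"
      using that fin by (intro sum.mono_neutral_cong_right) auto
    then show ?thesis by simp
  qed
  have total: "(\<Sum>e\<in>A \<union> B. w e * of_bool (e \<in> D)) = sum w D" if "D \<subseteq> A \<union> B" for D
    using that fin by (intro sum.mono_neutral_cong_right) auto
  have "(\<Sum>e\<in>A \<union> B. w e * of_bool (e \<in> A)) \<le> (\<Sum>e\<in>A \<union> B. w e * (real c * of_bool (e \<in> B)))"
  proof (rule weighted_sum_mono_levels)
    show "sum (\<lambda>e. of_bool (e \<in> A)) {e \<in> A \<union> B. t \<le> w e}
        \<le> sum (\<lambda>e. real c * of_bool (e \<in> B)) {e \<in> A \<union> B. t \<le> w e}" for t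
      unfolding sum_distrib_left[symmetric] ind[OF Un_upper1] ind[OF Un_upper2]
      using assms(4)[of t] by (simp flip: of_nat_mult)
  qed (use fin nonneg in auto)
  also have "\<dots> = real c * (\<Sum>e\<in>A \<union> B. w e * of_bool (e \<in> B))"
    by (simp add: sum_distrib_left mult.left_commute)
  finally show ?thesis
    unfolding total[OF Un_upper1] total[OF Un_upper2] .
qed

section \<open>Hulls, growth systems and matroids\<close>

lemma indep_systemD:
  assumes "indep_system S \<I>"
  shows "finite S" and "I \<in> \<I> \<Longrightarrow> I \<subseteq> S" and "I \<in> \<I> \<Longrightarrow> J \<subseteq> I \<Longrightarrow> J \<in> \<I>" and "{} \<in> \<I>"
    and "I \<in> \<I> \<Longrightarrow> finite I"
proof -
  show fin: "finite S" and sub: "I \<in> \<I> \<Longrightarrow> I \<subseteq> S" and down: "I \<in> \<I> \<Longrightarrow> J \<subseteq> I \<Longrightarrow> J \<in> \<I>" for I J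
    using assms unfolding indep_system_def by auto
  show "{} \<in> \<I>"
    using assms unfolding indep_system_def by auto
  show "I \<in> \<I> \<Longrightarrow> finite I"
    using fin sub finite_subset by blast
qed

lemma circuit_Diff_indep: "circuit S \<I> C \<Longrightarrow> e \<in> C \<Longrightarrow> C - {e} \<in> \<I>"
  by (auto simp: circuit_def)

lemma primitive_hull_mono: "X \<subseteq> Y \<Longrightarrow> primitive_hull S \<I> X \<subseteq> primitive_hull S \<I> Y"
  by (fastforce simp: primitive_hull_def)

lemma exists_basis_extending:
  assumes "indep_system S \<I>" and "finite X" and "I \<in> \<I>" and "I \<subseteq> X"
  obtains B where "basis_of \<I> X B" and "I \<subseteq> B"
proof -
  have "finite {B \<in> \<I>. I \<subseteq> B \<and> B \<subseteq> X}"
    using assms(2) by (auto intro: finite_subset[of _ "Pow X"])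
  from finite_has_maximal2[OF this, of I] assms(3,4)
  obtain B where B: "B \<in> \<I>" "I \<subseteq> B" "B \<subseteq> X"
      and max: "\<forall>J\<in>{B \<in> \<I>. I \<subseteq> B \<and> B \<subseteq> X}. B \<subseteq> J \<longrightarrow> B = J"
    by blast
  have "J = B" if "J \<in> \<I>" "B \<subseteq> J" "J \<subseteq> X" for J
    using bspec[OF max, of J] that B(2) by simp
  then show ?thesis
    using B by (intro that[of B]) (simp_all add: basis_of_def)
qed

text \<open>\<open>G\<close> is a basis of itself, so growth at \<open>X = G\<close> makes
  \<open>G \<union> Q\<close> independent. An element of \<open>Q\<close> would extend
  \<open>G\<close>, hence \<open>Q\<close> is empty and \<open>Z\<close> is all of
  \<open>I - G\<close>.\<close>

lemma growth_exchange:
  assumes gs: "growth_system k S \<I>" and I: "I \<in> \<I>" and G: "G \<in> \<I>"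
    and max: "\<And>e. e \<in> I - G \<Longrightarrow> insert e G \<notin> \<I>"
  shows "card (I - G) \<le> k * card (G - I)"
proof -
  have sys: "indep_system S \<I>"
    using gs by (simp add: growth_system_def)
  obtain Q Z where QZ: "Q \<union> Z = I - G" "card Z \<le> k * card (G - I)"
      "\<And>P. basis_of \<I> G P \<Longrightarrow> P \<union> Q \<in> \<I>"
    using gs I indep_systemD(2)[OF sys G] unfolding growth_system_def by metis
  have "G \<union> Q \<in> \<I>"
    using G by (intro QZ(3)) (auto simp: basis_of_def)
  have "Q = {}"
  proof (rule ccontr)
    assume "Q \<noteq> {}"
    then obtain e where "e \<in> Q" "e \<in> I - G"
      using QZ(1) by blast
    then show False
      using max indep_systemD(3)[OF sys \<open>G \<union> Q \<in> \<I>\<close>, of "insert e G"] by blast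
  qed
  with QZ show ?thesis by simp
qed

text \<open>Again \<open>Q\<close> is empty: an \<open>e\<close> in \<open>Q\<close> closes a
  circuit \<open>C\<close> with elements of \<open>X\<close>, some basis \<open>P\<close> of
  \<open>X\<close> contains \<open>C - {e}\<close>, and \<open>P \<union> Q\<close> would contain
  \<open>C\<close>. It matters that \<open>Q\<close> is fixed before \<open>P\<close>, because
  \<open>P\<close> depends on \<open>e\<close>.\<close>

lemma growth_card_hull_le:
  assumes gs: "growth_system k S \<I>" and T: "T \<in> \<I>" and X: "X \<subseteq> S"
    and hull: "T \<subseteq> primitive_hull S \<I> X" and disj: "T \<inter> X = {}"
  shows "card T \<le> k * card X"
proof -
  have sys: "indep_system S \<I>"
    using gs by (simp add: growth_system_def)
  have finX: "finite X"
    by (rule finite_subset[OF X indep_systemD(1)[OF sys]])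
  obtain Q Z where QZ: "Q \<union> Z = T - X" "card Z \<le> k * card (X - T)"
      "\<And>P. basis_of \<I> X P \<Longrightarrow> P \<union> Q \<in> \<I>"
    using gs T X unfolding growth_system_def by metis
  have "Q = {}"
  proof (rule ccontr)
    assume "Q \<noteq> {}"
    then obtain e where e: "e \<in> Q" by blast
    then have "e \<in> primitive_hull S \<I> X" "e \<notin> X"
      using QZ(1) hull by auto
    then obtain C where C: "circuit S \<I> C" "e \<in> C" "C \<subseteq> insert e X"
      unfolding primitive_hull_def by blast
    obtain P where "basis_of \<I> X P" "C - {e} \<subseteq> P"
      using exists_basis_extending[OF sys finX circuit_Diff_indep[OF C(1,2)]] C(3) by blast
    then have "P \<union> Q \<in> \<I>" "C \<subseteq> P \<union> Q"
      using QZ(3) e by blast+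
    then show False
      using C(1) indep_systemD(3)[OF sys] unfolding circuit_def by blast
  qed
  then have "card T \<le> k * card (X - T)"
    using QZ disj by (simp add: Diff_triv)
  also have "\<dots> \<le> k * card X"
    using finX by (simp add: card_mono)
  finally show ?thesis .
qed

text \<open>The cardinality bound applies at every weight level, because the elements of
  \<open>X\<close> whose hull contains \<open>e\<close> are heavier than \<open>e\<close> and so
  belong to each level that contains \<open>e\<close>.\<close>

lemma growth_weight_hull_le:
  fixes w :: "'a \<Rightarrow> real"
  assumes gs: "growth_system k S \<I>" and T: "T \<in> \<I>" and X: "X \<subseteq> S" and disj: "T \<inter> X = {}"
    and hull: "\<And>e. e \<in> T \<Longrightarrow> e \<in> primitive_hull S \<I> {f \<in> X. w f > w e}"
    and nonneg: "\<And>e. e \<in> S \<Longrightarrow> 0 \<le> w e"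
  shows "sum w T \<le> real k * sum w X"
proof (rule sum_le_if_card_levels_le)
  have sys: "indep_system S \<I>"
    using gs by (simp add: growth_system_def)
  show "finite T"
    by (rule indep_systemD(5)[OF sys T])
  show "finite X"
    by (rule finite_subset[OF X indep_systemD(1)[OF sys]])
  show "0 \<le> w e" if "e \<in> T \<union> X" for e
    using that X nonneg indep_systemD(2)[OF sys T] by blast
  show "card {e \<in> T. t \<le> w e} \<le> k * card {e \<in> X. t \<le> w e}" for t
  proof (rule growth_card_hull_le[OF gs])
    show "{e \<in> T. t \<le> w e} \<in> \<I>"
      by (rule indep_systemD(3)[OF sys T]) blast
    have "primitive_hull S \<I> {f \<in> X. w f > w e} \<subseteq> primitive_hull S \<I> {f \<in> X. t \<le> w f}"
      if "t \<le> w e" for e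
      using that by (intro primitive_hull_mono) auto
    then show "{e \<in> T. t \<le> w e} \<subseteq> primitive_hull S \<I> {f \<in> X. t \<le> w f}"
      using hull by blast
  qed (use X disj in auto)
qed

section \<open>Exchange and rank arguments for matroids\<close>

lemma matroid_augment:
  assumes "matroid S \<I>" and "I \<in> \<I>" and "J \<in> \<I>" and "card I < card J"
  shows "\<exists>e\<in>J - I. insert e I \<in> \<I>"
  using assms by (simp add: matroid_def)

text \<open>The counterpart of \<open>growth_exchange\<close> with factor 1, read off from
  augmentation: a larger \<open>I\<close> would extend \<open>G\<close>.\<close>

lemma matroid_exchange:
  assumes mat: "matroid S \<I>" and I: "I \<in> \<I>" and G: "G \<in> \<I>"
    and max: "\<And>e. e \<in> I - G \<Longrightarrow> insert e G \<notin> \<I>"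
  shows "card (I - G) \<le> card (G - I)"
proof -
  have sys: "indep_system S \<I>"
    using mat by (simp add: matroid_def)
  have "card I \<le> card G"
  proof (rule ccontr)
    assume "\<not> card I \<le> card G"
    then show False
      using matroid_augment[OF mat G I] max by auto
  qed
  then show ?thesis
    using indep_systemD(5)[OF sys] I G by (simp add: card_Diff_subset_Int Int_commute)
qed

text \<open>Passing to the hull does not raise the rank. If \<open>T\<close> were larger than a
  basis \<open>B\<close> of \<open>X\<close>, some \<open>f\<close> in the hull but outside
  \<open>X\<close> would extend \<open>B\<close>, and the circuit closed by \<open>f\<close> rules
  this out.\<close>

lemma matroid_hull_rank:
  assumes mat: "matroid S \<I>" and T: "T \<in> \<I>" and finX: "finite X"
    and hull: "T \<subseteq> primitive_hull S \<I> X"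
  obtains B where "B \<in> \<I>" and "B \<subseteq> X" and "card T \<le> card B"
proof -
  have sys: "indep_system S \<I>"
    using mat by (simp add: matroid_def)
  obtain B where B: "basis_of \<I> X B"
    using exists_basis_extending[OF sys finX indep_systemD(4)[OF sys]] by blast
  then have BI: "B \<in> \<I>" "B \<subseteq> X" and Bmax: "\<And>J. J \<in> \<I> \<Longrightarrow> B \<subseteq> J \<Longrightarrow> J \<subseteq> X \<Longrightarrow> J = B"
    by (auto simp: basis_of_def)
  have "card T \<le> card B"
  proof (rule ccontr)
    assume "\<not> card T \<le> card B"
    then obtain f where f: "f \<in> T - B" "insert f B \<in> \<I>"
      using matroid_augment[OF mat BI(1) T] by (auto simp: not_le)
    have "f \<notin> X"
      using Bmax[OF f(2)] f(1) BI(2) by blast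
    then obtain C where C: "circuit S \<I> C" "f \<in> C" "C \<subseteq> insert f X"
      using hull f(1) unfolding primitive_hull_def by blast
    \<comment> \<open>Being no larger than \<open>B\<close>, the basis \<open>B'\<close> can be
      augmented from \<open>insert f B\<close>. Adding \<open>f\<close> would complete the circuit
      \<open>C\<close>, and adding an element of \<open>B\<close> would violate the maximality of
      \<open>B'\<close>.\<close>
    obtain B' where B': "basis_of \<I> X B'" "C - {f} \<subseteq> B'"
      using exists_basis_extending[OF sys finX circuit_Diff_indep[OF C(1,2)]] C(3) by blast
    then have B'I: "B' \<in> \<I>" "B' \<subseteq> X" and B'max: "\<And>J. J \<in> \<I> \<Longrightarrow> B' \<subseteq> J \<Longrightarrow> J \<subseteq> X \<Longrightarrow> J = B'"
      by (auto simp: basis_of_def)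
    have "card B' \<le> card B"
    proof (rule ccontr)
      assume "\<not> card B' \<le> card B"
      then obtain g where "g \<in> B' - B" "insert g B \<in> \<I>"
        using matroid_augment[OF mat BI(1) B'I(1)] by (auto simp: not_le)
      then show False
        using Bmax[of "insert g B"] BI(2) B'I(2) by blast
    qed
    also have "card B < card (insert f B)"
      using f(1) indep_systemD(5)[OF sys BI(1)] by simp
    finally obtain g where g: "g \<in> insert f B - B'" "insert g B' \<in> \<I>"
      using matroid_augment[OF mat B'I(1) f(2)] by blast
    show False
    proof (cases "g = f")
      case True
      then have "C \<subseteq> insert g B'"
        using B'(2) by blast
      then show False
        using C(1) indep_systemD(3)[OF sys g(2)] unfolding circuit_def by blast
    next
      case False
      then show False
        using B'max[OF g(2)] g(1) BI(2) B'I(2) by blast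
    qed
  qed
  with BI show ?thesis using that by blast
qed

lemma primitive_core_subset: "primitive_core w S \<I> X \<subseteq> X"
  unfolding primitive_core_def by blast

text \<open>Remove the lightest element \<open>x\<close>, which influences the membership of no
  other element. Either \<open>x\<close> joins the core, or it lies in the hull of the rest and does
  not raise the rank.\<close>

lemma matroid_card_le_primitive_core:
  fixes w :: "'a \<Rightarrow> real"
  assumes mat: "matroid S \<I>" and finX: "finite X" and inj: "inj_on w X"
    and B: "B \<in> \<I>" "B \<subseteq> X"
  shows "card B \<le> card (primitive_core w S \<I> X)"
  using finX inj B
proof (induction X arbitrary: B rule: finite_psubset_induct)
  case (psubset X)
  have sys: "indep_system S \<I>"
    using mat by (simp add: matroid_def)
  show ?case
  proof (cases "X = {}")
    case False
    then obtain x where x: "x \<in> X" "\<And>f. f \<in> X \<Longrightarrow> w x \<le> w f"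
      using ex_min_if_finite[of "w ` X"] psubset.hyps by (fastforce simp: not_less)
    define X' where "X' = X - {x}"
    have X': "X' \<subset> X" "inj_on w X'" "finite X'"
      using x psubset by (auto simp: X'_def inj_on_def)
    have heavier: "{f \<in> X. w f > w e} = {f \<in> X'. w f > w e}" if "e \<in> X" for e
      using x(2)[OF that] by (auto simp: X'_def)
    have top: "{f \<in> X. w f > w x} = X'"
      using x psubset.prems(1) by (auto simp: X'_def inj_on_def less_le)
    have notin': "x \<notin> X'" and mem: "e \<in> X \<longleftrightarrow> e \<in> X' \<or> e = x" for e
      using x(1) by (auto simp: X'_def)
    have "e \<in> primitive_core w S \<I> X \<longleftrightarrow>
        e \<in> primitive_core w S \<I> X' \<or> e = x \<and> x \<notin> primitive_hull S \<I> X'" for e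
      using mem[of e] notin' x(1)
      by (cases "e = x"; cases "e \<in> X") (simp_all add: primitive_core_def top heavier)
    then have core: "primitive_core w S \<I> X
        = primitive_core w S \<I> X' \<union> (if x \<in> primitive_hull S \<I> X' then {} else {x})"
      by auto
    have fin: "finite (primitive_core w S \<I> X')" and notin: "x \<notin> primitive_core w S \<I> X'"
      using primitive_core_subset[of w S \<I> X'] X'(3) by (auto simp: X'_def intro: finite_subset)
    show ?thesis
    proof (cases "x \<in> primitive_hull S \<I> X'")
      case True
      have "X' \<subseteq> primitive_hull S \<I> X'"
        unfolding primitive_hull_def by blast
      then have "B \<subseteq> primitive_hull S \<I> X'"
        using True psubset.prems(3) by (auto simp: X'_def)
      \<comment> \<open>\<open>B\<close> may contain \<open>x\<close>, but \<open>X'\<close> alone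
        has an independent subset at least as large.\<close>
      from matroid_hull_rank[OF mat psubset.prems(2) X'(3) this]
      obtain B' where B': "B' \<in> \<I>" "B' \<subseteq> X'" "card B \<le> card B'" .
      then show ?thesis
        using psubset.IH[OF X'(1,2) B'(1,2)] core True by simp
    next
      case False
      have "card (B - {x}) \<le> card (primitive_core w S \<I> X')"
        using psubset.prems(3) indep_systemD(3)[OF sys psubset.prems(2)]
        by (intro psubset.IH X') (auto simp: X'_def)
      moreover have "card B \<le> Suc (card (B - {x}))"
        using indep_systemD(5)[OF sys psubset.prems(2)]
        by (metis card_Suc_Diff1 Diff_empty Diff_insert0 le_SucI order_refl)
      ultimately show ?thesis
        using core False fin notin by simp
    qed
  qed (use psubset.prems in simp)
qed

text \<open>Whether \<open>e\<close> survives depends only on strictly heavier elements, so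
  truncation at a weight level commutes with the primitive core.\<close>

lemma primitive_core_level:
  "primitive_core w S \<I> {f \<in> X. t \<le> w f} = {e \<in> primitive_core w S \<I> X. t \<le> w e}"
proof -
  have "{f \<in> {f \<in> X. t \<le> w f}. w f > w e} = {f \<in> X. w f > w e}" if "t \<le> w e" for e
    using that by auto
  then show ?thesis
    unfolding primitive_core_def by auto
qed

text \<open>At each level, \<open>T\<close> lies in the hull of that level of \<open>X\<close>, so
  its size is at most the rank there, which the primitive core reaches. The alternative
  \<open>e \<in> X\<close> serves the case \<open>k = 1\<close>, where \<open>T\<close> is an
  independent subset of \<open>X\<close>.\<close>

lemma matroid_weight_hull_le:
  fixes w :: "'a \<Rightarrow> real"
  assumes mat: "matroid S \<I>" and T: "T \<in> \<I>" and X: "X \<subseteq> S" and inj: "inj_on w S"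
    and hull: "\<And>e. e \<in> T \<Longrightarrow> e \<in> X \<or> e \<in> primitive_hull S \<I> {f \<in> X. w f > w e}"
    and nonneg: "\<And>e. e \<in> S \<Longrightarrow> 0 \<le> w e"
  shows "sum w T \<le> sum w (primitive_core w S \<I> X)"
proof -
  have sys: "indep_system S \<I>"
    using mat by (simp add: matroid_def)
  have finX: "finite X"
    by (rule finite_subset[OF X indep_systemD(1)[OF sys]])
  have "sum w T \<le> real 1 * sum w (primitive_core w S \<I> X)"
  proof (rule sum_le_if_card_levels_le)
    show "finite T"
      by (rule indep_systemD(5)[OF sys T])
    show "finite (primitive_core w S \<I> X)"
      using finite_subset[OF primitive_core_subset finX] .
    show "0 \<le> w e" if "e \<in> T \<union> primitive_core w S \<I> X" for e
      using that X nonneg indep_systemD(2)[OF sys T] primitive_core_subset[of w S \<I> X] by blast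
    show "card {e \<in> T. t \<le> w e} \<le> 1 * card {e \<in> primitive_core w S \<I> X. t \<le> w e}" for t
    proof -
      let ?X = "{f \<in> X. t \<le> w f}"
      have "primitive_hull S \<I> {f \<in> X. w f > w e} \<subseteq> primitive_hull S \<I> ?X" if "t \<le> w e" for e
        using that by (intro primitive_hull_mono) auto
      moreover have "?X \<subseteq> primitive_hull S \<I> ?X"
        unfolding primitive_hull_def by blast
      ultimately have sub: "{e \<in> T. t \<le> w e} \<subseteq> primitive_hull S \<I> ?X"
        using hull by blast
      have indep: "{e \<in> T. t \<le> w e} \<in> \<I>"
        by (rule indep_systemD(3)[OF sys T]) blast
      have finX': "finite ?X"
        using finX by simp
      from matroid_hull_rank[OF mat indep finX' sub]
      obtain B where B: "B \<in> \<I>" "B \<subseteq> ?X" "card {e \<in> T. t \<le> w e} \<le> card B" .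
      have "inj_on w ?X"
        using inj X by (auto intro: inj_on_subset)
      from matroid_card_le_primitive_core[OF mat finX' this B(1,2)] B(3) show ?thesis
        by (simp add: primitive_core_level)
    qed
  qed
  then show ?thesis by simp
qed

section \<open>The greedy algorithm\<close>

definition candidate :: "('a \<Rightarrow> real) \<Rightarrow> 'a set set \<Rightarrow> 'a set \<Rightarrow> 'a \<Rightarrow> bool" where
  "candidate w \<I> Y e \<longleftrightarrow> insert e (greedy w \<I> {f \<in> Y. w f > w e}) \<in> \<I>"

lemma candidate_cong:
  assumes "{f \<in> Y. w f > w e} = {f \<in> Y'. w f > w e}"
  shows "candidate w \<I> Y e = candidate w \<I> Y' e"
  using assms by (simp add: candidate_def)

text \<open>Outside class \<open>linorder\<close>, the library facts on \<open>sorted_key_list_of_set\<close> are stated for the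
  locale constant, which is not syntactically the constant of the class instance.\<close>

lemma linorder_sorted_key_list_of_set:
  "linorder.sorted_key_list_of_set (\<le>) = (sorted_key_list_of_set :: ('b \<Rightarrow> 'a::linorder) \<Rightarrow> _)"
proof -
  have "linorder.insort_key (\<le>) f x xs = insort_key f x xs" for f :: "'b \<Rightarrow> 'a" and x xs
    by (induction xs) (simp_all add: linorder.insort_key.simps[OF linorder_class.linorder_axioms])
  then have "linorder.insort_key (\<le>) = (insort_key :: ('b \<Rightarrow> 'a) \<Rightarrow> _)"
    by (intro ext)
  then show ?thesis
    by (intro ext) (simp add: sorted_key_list_of_set_def
        linorder.sorted_key_list_of_set_def[OF linorder_class.linorder_axioms])
qed

locale weighted_indep_system =
  fixes S :: "'a set" and \<I> :: "'a set set" and w :: "'a \<Rightarrow> real"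
  assumes sys: "indep_system S \<I>" and inj: "inj_on w S"
begin

text \<open>Injectivity of \<open>w\<close> on \<open>S\<close> is the injectivity of the sort key
  required here; the rewrite makes the facts speak of the constant used in
  \<open>greedy\<close>.\<close>

sublocale keys: folding_insort_key "(\<le>)" "(<)" S "\<lambda>x. - w x"
  rewrites "linorder.sorted_key_list_of_set (\<le>) = (sorted_key_list_of_set :: ('a \<Rightarrow> real) \<Rightarrow> _)"
  by unfold_locales (use inj in \<open>auto simp: inj_on_def linorder_sorted_key_list_of_set\<close>)

text \<open>The lightest element is last in the processing order, so it contributes one final step
  of the fold.\<close>

lemma greedy_insert_lightest:
  assumes X: "insert x X \<subseteq> S" and light: "\<And>f. f \<in> X \<Longrightarrow> w x < w f"
  shows "greedy w \<I> (insert x X)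
    = (if insert x (greedy w \<I> X) \<in> \<I> then insert x (greedy w \<I> X) else greedy w \<I> X)"
proof -
  define l where "l = sorted_key_list_of_set (\<lambda>x. - w x) X"
  have XS: "X \<subseteq> S"
    using X by simp
  have "finite X"
    by (rule finite_subset[OF XS indep_systemD(1)[OF sys]])
  then have l: "set l = X" "sorted (map (\<lambda>x. - w x) l)" "distinct l"
    using XS keys.distinct_if_distinct_map[OF keys.distinct_sorted_key_list_of_set] by (simp_all add: l_def)
  have "sorted_key_list_of_set (\<lambda>x. - w x) (set (l @ [x])) = l @ [x]"
  proof (rule keys.idem_if_sorted_distinct)
    show "sorted (map (\<lambda>x. - w x) (l @ [x]))"
      using l light by (simp add: sorted_append less_imp_le)
    show "distinct (l @ [x])"
      using l light by auto
  qed (use l X in auto)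
  moreover have "set (l @ [x]) = insert x X"
    using l by simp
  ultimately have "sorted_key_list_of_set (\<lambda>x. - w x) (insert x X) = l @ [x]"
    by simp
  then show ?thesis
    by (simp add: greedy_def l_def)
qed

text \<open>Removing the lightest element changes no candidate status of the others, and its own
  status is the test in the last greedy step. The run thus becomes a pointwise condition.\<close>

lemma greedy_indep_and_eq:
  assumes "X \<subseteq> S"
  shows "greedy w \<I> X \<in> \<I> \<and> greedy w \<I> X = {e \<in> X. candidate w \<I> X e}"
proof -
  have "finite X"
    by (rule finite_subset[OF assms indep_systemD(1)[OF sys]])
  then show ?thesis
    using assms
  proof (induction X rule: finite_psubset_induct)
    case (psubset X)
    show ?case
    proof (cases "X = {}")
      case True
      then show ?thesis
        using indep_systemD(4)[OF sys] by (simp add: greedy_def)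
    next
      case False
      then obtain x where x: "x \<in> X" "\<And>f. f \<in> X \<Longrightarrow> w x \<le> w f"
        using ex_min_if_finite[of "w ` X"] psubset.hyps by (fastforce simp: not_less)
      define X' where "X' = X - {x}"
      have X: "X = insert x X'" and notin: "x \<notin> X'" and X': "X' \<subset> X" "X' \<subseteq> S"
        using x psubset.prems by (auto simp: X'_def)
      have less: "w x < w f" if "f \<in> X'" for f
        using that x(1) x(2)[of f] psubset.prems inj_on_contraD[OF inj, of x f]
        by (auto simp: X'_def less_le)
      have heavier: "{f \<in> X. w f > w e} = {f \<in> X'. w f > w e}" if "e \<in> X" for e
        using x(2)[OF that] by (auto simp: X'_def)
      have "{f \<in> X. w f > w x} = X'"
        using less by (auto simp: X)
      then have cand_x: "candidate w \<I> X x \<longleftrightarrow> insert x (greedy w \<I> X') \<in> \<I>"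
        by (simp add: candidate_def)
      have cand: "candidate w \<I> X e = candidate w \<I> X' e" if "e \<in> X'" for e
        using heavier that X'(1) by (intro candidate_cong) auto
      have rec: "greedy w \<I> X
          = (if insert x (greedy w \<I> X') \<in> \<I> then insert x (greedy w \<I> X') else greedy w \<I> X')"
        using greedy_insert_lightest[of x X'] less psubset.prems X by simp
      have IH: "greedy w \<I> X' \<in> \<I>" "greedy w \<I> X' = {e \<in> X'. candidate w \<I> X' e}"
        using psubset.IH[OF X'] by auto
      have "{e \<in> X. candidate w \<I> X e}
          = (if candidate w \<I> X x then {x} else {}) \<union> {e \<in> X'. candidate w \<I> X' e}"
        using cand X by auto
      then show ?thesis
        using rec IH cand_x by simp
    qed
  qed
qed

lemmas greedy_indep = greedy_indep_and_eq[THEN conjunct1]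
lemmas greedy_eq = greedy_indep_and_eq[THEN conjunct2]

lemma greedy_heavier_subset:
  assumes "X \<subseteq> S"
  shows "greedy w \<I> {f \<in> X. w f > t} \<subseteq> {f \<in> greedy w \<I> X. w f > t}"
proof -
  have "candidate w \<I> X e" if "candidate w \<I> {f \<in> X. w f > t} e" "w e > t" for e
  proof -
    have "{f \<in> {f \<in> X. w f > t}. w f > w e} = {f \<in> X. w f > w e}"
      using that(2) by auto
    from candidate_cong[OF this] that(1) show ?thesis
      by simp
  qed
  moreover have "{f \<in> X. w f > t} \<subseteq> S"
    using assms by auto
  ultimately show ?thesis
    using assms by (auto simp: greedy_eq)
qed

text \<open>\<open>e\<close> was rejected because of the greedy choice among heavier elements, and
  that choice is contained in the level. This supplies the maximality for the exchange
  argument.\<close>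

lemma greedy_level_maximal:
  assumes X: "X \<subseteq> S" and e: "e \<in> X" "t \<le> w e" "e \<notin> greedy w \<I> X"
  shows "insert e {f \<in> greedy w \<I> X. t \<le> w f} \<notin> \<I>"
proof
  assume *: "insert e {f \<in> greedy w \<I> X. t \<le> w f} \<in> \<I>"
  have "insert e (greedy w \<I> {f \<in> X. w f > w e}) \<subseteq> insert e {f \<in> greedy w \<I> X. t \<le> w f}"
    using greedy_heavier_subset[OF X, of "w e"] e(2) by auto
  then have "insert e (greedy w \<I> {f \<in> X. w f > w e}) \<in> \<I>"
    by (rule indep_systemD(3)[OF sys *])
  then have "candidate w \<I> X e"
    by (simp add: candidate_def)
  then show False
    using e X by (simp add: greedy_eq)
qed

lemma rel_eq:
  assumes "Y \<subseteq> S"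
  shows "rel w S \<I> Y = {e \<in> S - Y. candidate w \<I> Y e}"
proof -
  have "e \<in> greedy w \<I> (insert e Y) \<longleftrightarrow> candidate w \<I> Y e" if "e \<in> S" for e
  proof -
    have "{f \<in> insert e Y. w f > w e} = {f \<in> Y. w f > w e}"
      by auto
    then show ?thesis
      using that assms candidate_cong[of "insert e Y" w e Y] by (simp add: greedy_eq)
  qed
  then show ?thesis
    by (auto simp: rel_def)
qed

text \<open>Above \<open>t\<close>, both candidacy and membership in \<open>Y\<close> read only the
  part of \<open>Y\<close> above \<open>t\<close>. With \<open>t = w e\<close> this compares
  \<open>Y\<close> with \<open>insert e Y\<close>.\<close>

lemma rel_heavier_cong:
  assumes "Y \<subseteq> S" "Y' \<subseteq> S" and eq: "{f \<in> Y. w f > t} = {f \<in> Y'. w f > t}"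
  shows "{f \<in> rel w S \<I> Y. w f > t} = {f \<in> rel w S \<I> Y'. w f > t}"
proof -
  have "candidate w \<I> Y e = candidate w \<I> Y' e" and "e \<in> Y \<longleftrightarrow> e \<in> Y'" if "w e > t" for e
  proof -
    have "{f \<in> Y. w f > w e} = {f \<in> {f \<in> Y. w f > t}. w f > w e}"
      using that by auto
    also have "\<dots> = {f \<in> Y'. w f > w e}"
      unfolding eq using that by auto
    finally show "candidate w \<I> Y e = candidate w \<I> Y' e"
      by (rule candidate_cong)
    show "e \<in> Y \<longleftrightarrow> e \<in> Y'"
      using eq that by (auto simp: set_eq_iff)
  qed
  then show ?thesis
    using assms(1,2) by (auto simp: rel_eq)
qed

end

section \<open>Random subsets\<close>

lemma set_random_subset: "finite S \<Longrightarrow> Y \<in> set_pmf (random_subset S p) \<Longrightarrow> Y \<subseteq> S"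
  by (auto simp: random_subset_def)

lemma finite_set_random_subset: "finite S \<Longrightarrow> finite (set_pmf (random_subset S p))"
  by (rule finite_subset[of _ "Pow S"]) (auto dest: set_random_subset)

lemma integrable_random_subset:
  fixes F :: "'a set \<Rightarrow> real"
  shows "finite S \<Longrightarrow> integrable (measure_pmf (random_subset S p)) F"
  by (intro integrable_measure_pmf_finite finite_set_random_subset)

lemma expectation_random_subset_cong:
  fixes F G :: "'a set \<Rightarrow> real"
  assumes "finite S" "\<And>Y. Y \<subseteq> S \<Longrightarrow> F Y = G Y"
  shows "measure_pmf.expectation (random_subset S p) F = measure_pmf.expectation (random_subset S p) G"
  using assms set_random_subset[OF assms(1)] by (intro integral_cong_AE) (auto simp: AE_measure_pmf_iff)

lemma expectation_random_subset_mono: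
  fixes F G :: "'a set \<Rightarrow> real"
  assumes "finite S" "\<And>Y. Y \<subseteq> S \<Longrightarrow> F Y \<le> G Y"
  shows "measure_pmf.expectation (random_subset S p) F \<le> measure_pmf.expectation (random_subset S p) G"
  using assms set_random_subset[OF assms(1)]
  by (intro integral_mono_AE integrable_random_subset) (auto simp: AE_measure_pmf_iff)

text \<open>Tosses the coin of \<open>e\<close> first and then samples the rest, which prepares
  conditioning on that coin.\<close>

lemma random_subset_split:
  assumes "finite S" "e \<in> S"
  shows "random_subset S p = bernoulli_pmf p \<bind>
    (\<lambda>b. map_pmf (\<lambda>Y. if b then insert e Y else Y) (random_subset (S - {e}) p))"
proof -
  have "Pi_pmf S False (\<lambda>_. bernoulli_pmf p) = bernoulli_pmf p \<bind>
      (\<lambda>b. map_pmf (\<lambda>f. f(e := b)) (Pi_pmf (S - {e}) False (\<lambda>_. bernoulli_pmf p)))"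
    using Pi_pmf_insert'[of "S - {e}" e False "\<lambda>_. bernoulli_pmf p"] assms
    by (simp add: insert_absorb map_pmf_def)
  then have "random_subset S p = bernoulli_pmf p \<bind>
      (\<lambda>b. map_pmf (\<lambda>f. {x \<in> S. (f(e := b)) x}) (Pi_pmf (S - {e}) False (\<lambda>_. bernoulli_pmf p)))"
    by (simp add: random_subset_def map_bind_pmf pmf.map_comp o_def)
  also have "\<dots> = bernoulli_pmf p \<bind>
    (\<lambda>b. map_pmf (\<lambda>Y. if b then insert e Y else Y) (random_subset (S - {e}) p))"
    unfolding random_subset_def pmf.map_comp
    using assms by (intro bind_pmf_cong refl map_pmf_cong) auto
  finally show ?thesis .
qed

lemma expectation_random_subset_split:
  fixes F :: "'a set \<Rightarrow> real"
  assumes "finite S" "e \<in> S" "0 \<le> p" "p \<le> 1"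
  shows "measure_pmf.expectation (random_subset S p) F
    = p * measure_pmf.expectation (random_subset (S - {e}) p) (\<lambda>Y. F (insert e Y))
    + (1 - p) * measure_pmf.expectation (random_subset (S - {e}) p) F"
  unfolding random_subset_split[OF assms(1,2)] using assms
  by (subst pmf_expectation_bind[of UNIV])
    (auto simp: UNIV_bool finite_set_random_subset)

text \<open>\<open>\<phi>\<close> ignores the coin of \<open>e\<close>, so it is independent of the
  event that \<open>e\<close> is sampled.\<close>

lemma expectation_mem_random_subset:
  fixes \<phi> :: "'a set \<Rightarrow> real"
  assumes "finite S" "e \<in> S" "0 \<le> p" "p \<le> 1"
    and inv: "\<And>Y. Y \<subseteq> S - {e} \<Longrightarrow> \<phi> (insert e Y) = \<phi> Y"
  shows "measure_pmf.expectation (random_subset S p) (\<lambda>Y. of_bool (e \<in> Y) * \<phi> Y)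
      = p * measure_pmf.expectation (random_subset S p) \<phi>"
    and "measure_pmf.expectation (random_subset S p) (\<lambda>Y. of_bool (e \<notin> Y) * \<phi> Y)
      = (1 - p) * measure_pmf.expectation (random_subset S p) \<phi>"
proof -
  let ?E = "measure_pmf.expectation (random_subset (S - {e}) p)"
  have fin: "finite (S - {e})"
    using assms by simp
  have eq: "?E (\<lambda>Y. \<phi> (insert e Y)) = ?E \<phi>"
    by (rule expectation_random_subset_cong[OF fin inv])
  have zero: "?E (\<lambda>Y. of_bool (e \<in> Y) * \<phi> Y) = ?E (\<lambda>_. 0)"
    and one: "?E (\<lambda>Y. of_bool (e \<notin> Y) * \<phi> Y) = ?E \<phi>"
    by (intro expectation_random_subset_cong[OF fin]; auto)+
  show "measure_pmf.expectation (random_subset S p) (\<lambda>Y. of_bool (e \<in> Y) * \<phi> Y)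
      = p * measure_pmf.expectation (random_subset S p) \<phi>"
    and "measure_pmf.expectation (random_subset S p) (\<lambda>Y. of_bool (e \<notin> Y) * \<phi> Y)
      = (1 - p) * measure_pmf.expectation (random_subset S p) \<phi>"
    unfolding expectation_random_subset_split[OF assms(1-4)] zero one eq
    by (simp_all add: eq algebra_simps)
qed

text \<open>Both coin outcomes yield the same sum over \<open>A\<close>, with factors
  \<open>p\<close> and \<open>1 - p\<close>. Bounds between sampled and unsampled weights thereby
  become bounds between such sums.\<close>

lemma expectation_weight_random_subset:
  fixes w :: "'a \<Rightarrow> real"
  assumes "finite S" "A \<subseteq> S" "0 \<le> p" "p \<le> 1"
    and inv: "\<And>e Y. e \<in> A \<Longrightarrow> Y \<subseteq> S - {e} \<Longrightarrow> P (insert e Y) e = P Y e"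
  shows "measure_pmf.expectation (random_subset S p) (\<lambda>Y. sum w {e \<in> A \<inter> Y. P Y e})
      = p * (\<Sum>e\<in>A. w e * measure_pmf.expectation (random_subset S p) (\<lambda>Y. of_bool (P Y e)))"
    and "measure_pmf.expectation (random_subset S p) (\<lambda>Y. sum w {e \<in> A - Y. P Y e})
      = (1 - p) * (\<Sum>e\<in>A. w e * measure_pmf.expectation (random_subset S p) (\<lambda>Y. of_bool (P Y e)))"
proof -
  let ?E = "measure_pmf.expectation (random_subset S p)"
  have finA: "finite A"
    using assms finite_subset by blast
  have "sum w {e \<in> A \<inter> Y. P Y e} = (\<Sum>e\<in>A. w e * (of_bool (e \<in> Y) * of_bool (P Y e)))" for Y
    using finA by (intro sum.mono_neutral_cong_left) auto
  moreover have "sum w {e \<in> A - Y. P Y e} = (\<Sum>e\<in>A. w e * (of_bool (e \<notin> Y) * of_bool (P Y e)))" for Y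
    using finA by (intro sum.mono_neutral_cong_left) auto
  moreover have "?E (\<lambda>Y. \<Sum>e\<in>A. w e * G e Y) = (\<Sum>e\<in>A. w e * ?E (G e))" for G
    using assms(1) by (simp add: integrable_random_subset Bochner_Integration.integral_sum)
  moreover have "?E (\<lambda>Y. of_bool (e \<in> Y) * of_bool (P Y e)) = p * ?E (\<lambda>Y. of_bool (P Y e))"
    "?E (\<lambda>Y. of_bool (e \<notin> Y) * of_bool (P Y e)) = (1 - p) * ?E (\<lambda>Y. of_bool (P Y e))"
    if "e \<in> A" for e
    using that assms(1-4) inv[OF that] by (intro expectation_mem_random_subset; auto)+
  ultimately show "?E (\<lambda>Y. sum w {e \<in> A \<inter> Y. P Y e}) = p * (\<Sum>e\<in>A. w e * ?E (\<lambda>Y. of_bool (P Y e)))"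
    and "?E (\<lambda>Y. sum w {e \<in> A - Y. P Y e}) = (1 - p) * (\<Sum>e\<in>A. w e * ?E (\<lambda>Y. of_bool (P Y e)))"
    by (simp_all add: sum_distrib_left mult.left_commute cong: sum.cong)
qed

section \<open>Combinations\<close>

text \<open>Double counting: after exchanging the sums, \<open>h e\<close> carries the total
  \<open>\<kappa>\<close> of the components containing \<open>e\<close>.\<close>

lemma weighted_sum_components_le:
  fixes h :: "'a \<Rightarrow> real" and \<kappa> :: "'b \<Rightarrow> nat"
  assumes "finite F" "finite J" and "\<And>e. e \<in> F \<Longrightarrow> 0 \<le> h e"
    and "\<And>e. e \<in> F \<Longrightarrow> (\<Sum>j | j \<in> J \<and> e \<in> A j. \<kappa> j) \<le> k"
  shows "(\<Sum>j\<in>J. real (\<kappa> j) * sum h (F \<inter> A j)) \<le> real k * sum h F"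
proof -
  have "sum h (F \<inter> A j) = (\<Sum>e\<in>F. if e \<in> A j then h e else 0)" for j
    using assms(1) by (rule sum.inter_restrict)
  then have "(\<Sum>j\<in>J. real (\<kappa> j) * sum h (F \<inter> A j))
      = (\<Sum>j\<in>J. \<Sum>e\<in>F. if e \<in> A j then real (\<kappa> j) * h e else 0)"
    by (simp add: sum_distrib_left if_distrib cong: if_cong)
  also have "\<dots> = (\<Sum>e\<in>F. \<Sum>j\<in>J. if e \<in> A j then real (\<kappa> j) * h e else 0)"
    by (rule sum.swap)
  also have "\<dots> = (\<Sum>e\<in>F. real (\<Sum>j | j \<in> J \<and> e \<in> A j. \<kappa> j) * h e)"
  proof (rule sum.cong[OF refl])
    fix e
    have "{j \<in> J. e \<in> A j} = {j. j \<in> J \<and> e \<in> A j}" by simp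
    then show "(\<Sum>j\<in>J. if e \<in> A j then real (\<kappa> j) * h e else 0)
        = real (\<Sum>j | j \<in> J \<and> e \<in> A j. \<kappa> j) * h e"
      using assms(2) by (simp add: sum.inter_filter[symmetric] sum_distrib_right)
  qed
  also have "\<dots> \<le> (\<Sum>e\<in>F. real k * h e)"
    using assms(3,4) by (intro sum_mono mult_right_mono) (auto simp del: of_nat_sum)
  finally show ?thesis
    by (simp add: sum_distrib_left)
qed

locale combined_system =
  fixes M :: nat and Sj :: "nat \<Rightarrow> 'a set" and Ij :: "nat \<Rightarrow> 'a set set" and w :: "'a \<Rightarrow> real"
  assumes comp: "\<And>j. j \<in> {1..M} \<Longrightarrow> indep_system (Sj j) (Ij j)"
    and nonempty: "comb_ground M Sj \<noteq> {}"
    and nonneg: "\<And>e. e \<in> comb_ground M Sj \<Longrightarrow> 0 \<le> w e"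
    and w_inj: "inj_on w (comb_ground M Sj)"
begin

abbreviation "S \<equiv> comb_ground M Sj"
abbreviation "\<F> \<equiv> comb_indep M Sj Ij"
abbreviation "Rel \<equiv> rel w S \<F>"

lemma component_subset: "j \<in> {1..M} \<Longrightarrow> Sj j \<subseteq> S"
  unfolding comb_ground_def by blast

lemma M_pos: "0 < M"
  using nonempty by (auto simp: comb_ground_def)

lemma comb_indep_iff: "I \<in> \<F> \<longleftrightarrow> I \<subseteq> S \<and> (\<forall>j\<in>{1..M}. I \<inter> Sj j \<in> Ij j)"
  by (simp add: comb_indep_def)

lemma indep_system_comb: "indep_system S \<F>"
proof -
  have "finite S"
    using indep_systemD(1)[OF comp] by (auto simp: comb_ground_def)
  moreover have "{} \<in> \<F>"
    using indep_systemD(4)[OF comp] by (simp add: comb_indep_iff)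
  moreover have "J \<in> \<F>" if "I \<in> \<F>" "J \<subseteq> I" for I J
  proof -
    have "J \<inter> Sj j \<in> Ij j" if j: "j \<in> {1..M}" for j
    proof (rule indep_systemD(3)[OF comp[OF j]])
      show "I \<inter> Sj j \<in> Ij j"
        using j \<open>I \<in> \<F>\<close> by (simp add: comb_indep_iff)
    qed (use \<open>J \<subseteq> I\<close> in auto)
    then show ?thesis
      using that by (auto simp: comb_indep_iff)
  qed
  moreover have "\<F> \<subseteq> Pow S"
    by (auto simp: comb_indep_iff)
  ultimately show ?thesis
    unfolding indep_system_def by auto
qed

sublocale weighted_indep_system S \<F> w
  by unfold_locales (fact indep_system_comb, fact w_inj)

lemma finite_ground: "finite S"
  by (rule indep_systemD(1)[OF sys])

lemma Rel_subset: "Rel Y \<subseteq> S"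
  by (auto simp: rel_def)

lemma core_eq:
  assumes "N \<subseteq> S"
  shows "core w M Sj Ij N
    = {e \<in> N. \<forall>j\<in>{1..M}. e \<in> Sj j \<longrightarrow> e \<in> primitive_core w (Sj j) (Ij j) (N \<inter> Sj j)}"
proof -
  have "primitive_core w (Sj j) (Ij j) (N \<inter> Sj j) \<subseteq> N \<inter> Sj j" for j
    by (rule primitive_core_subset)
  \<comment> \<open>With no components the intersection in \<open>core\<close> would be the whole
    type instead of a subset of \<open>N\<close>.\<close>
  moreover have "1 \<in> {1..M}"
    using M_pos by simp
  ultimately show ?thesis
    unfolding core_def by blast
qed

section \<open>Blocked elements and the weight lost to them\<close>

text \<open>The primitive core of component \<open>j\<close> discards the blocked elements of \<open>Rel Y\<close>; they are
  charged to the blocked elements of \<open>Y\<close>.\<close>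

definition blocked :: "nat \<Rightarrow> 'a set \<Rightarrow> 'a \<Rightarrow> bool" where
  "blocked j Y e \<longleftrightarrow> candidate w \<F> Y e \<and>
    e \<in> primitive_hull (Sj j) (Ij j) {f \<in> Rel Y \<inter> Sj j. w f > w e}"

lemma candidate_insert_self: "candidate w \<F> (insert e Y) e = candidate w \<F> Y e"
  by (rule candidate_cong) auto

lemma blocked_insert_self:
  assumes "e \<in> S" "Y \<subseteq> S"
  shows "blocked j (insert e Y) e = blocked j Y e"
proof -
  have "{f \<in> Rel (insert e Y). w f > w e} = {f \<in> Rel Y. w f > w e}"
    using assms by (intro rel_heavier_cong) auto
  then have "{f \<in> Rel (insert e Y) \<inter> Sj j. w f > w e} = {f \<in> Rel Y \<inter> Sj j. w f > w e}"
    by auto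
  then show ?thesis
    by (simp add: blocked_def candidate_insert_self)
qed

lemma Rel_component:
  assumes "j \<in> {1..M}" "Y \<subseteq> S"
  shows "Rel Y \<inter> Sj j = {e \<in> Sj j - Y. candidate w \<F> Y e}"
  using component_subset[OF assms(1)] by (auto simp: rel_eq[OF assms(2)])

lemma blocked_eq_discarded:
  assumes "j \<in> {1..M}" "Y \<subseteq> S"
  shows "{e \<in> Sj j - Y. blocked j Y e}
    = Rel Y \<inter> Sj j - primitive_core w (Sj j) (Ij j) (Rel Y \<inter> Sj j)"
  using Rel_component[OF assms] by (auto simp: blocked_def primitive_core_def)

text \<open>A blocked element of \<open>Y\<close> is a candidate in \<open>Y\<close>, hence chosen
  by the greedy run, whose trace on each component is independent.\<close>

lemma blocked_sample_indep:
  assumes "j \<in> {1..M}" "Y \<subseteq> S"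
  shows "{e \<in> Sj j \<inter> Y. blocked j Y e} \<in> Ij j"
proof (rule indep_systemD(3)[OF comp[OF assms(1)]])
  show "greedy w \<F> Y \<inter> Sj j \<in> Ij j"
    using greedy_indep[OF assms(2)] assms(1) by (simp add: comb_indep_iff)
  show "{e \<in> Sj j \<inter> Y. blocked j Y e} \<subseteq> greedy w \<F> Y \<inter> Sj j"
    by (auto simp: greedy_eq[OF assms(2)] blocked_def)
qed

text \<open>The core is \<open>Rel Y\<close> minus the discarded elements of all components. A union
  bound suffices, since weights are nonnegative.\<close>

lemma weight_core_Rel_ge:
  assumes "Y \<subseteq> S"
  shows "sum w {e \<in> S - Y. candidate w \<F> Y e} - (\<Sum>j\<in>{1..M}. sum w {e \<in> Sj j - Y. blocked j Y e})
    \<le> sum w (core w M Sj Ij (Rel Y))"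
proof -
  let ?core = "core w M Sj Ij (Rel Y)"
  define B where "B j = {e \<in> Sj j - Y. blocked j Y e}" for j
  have BS: "B j \<subseteq> S" if "j \<in> {1..M}" for j
    using component_subset[OF that] by (auto simp: B_def)
  have finB: "finite (B j)" if "j \<in> {1..M}" for j
    by (rule finite_subset[OF BS[OF that] finite_ground])
  have core: "?core = Rel Y - (\<Union>j\<in>{1..M}. B j)"
  proof -
    have "(\<Union>j\<in>{1..M}. B j)
        = (\<Union>j\<in>{1..M}. Rel Y \<inter> Sj j - primitive_core w (Sj j) (Ij j) (Rel Y \<inter> Sj j))"
      unfolding B_def by (intro SUP_cong refl blocked_eq_discarded assms)
    then show ?thesis
      unfolding core_eq[OF Rel_subset] by blast
  qed
  have finR: "finite (Rel Y)"
    by (rule finite_subset[OF Rel_subset finite_ground])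
  have "sum w (Rel Y) \<le> sum w ?core + sum w (\<Union>j\<in>{1..M}. B j)"
  proof -
    have "sum w (Rel Y) \<le> sum w (?core \<union> (\<Union>j\<in>{1..M}. B j))"
    proof (intro sum_mono2)
      show "finite (?core \<union> (\<Union>j\<in>{1..M}. B j))"
        using finR finB by (simp add: core)
      have "(\<Union>j\<in>{1..M}. B j) \<subseteq> S"
        using BS by (rule UN_least)
      then show "0 \<le> w e" if "e \<in> ?core \<union> (\<Union>j\<in>{1..M}. B j) - Rel Y" for e
        using that nonneg by (auto simp: core)
    qed (auto simp: core)
    also have "\<dots> = sum w ?core + sum w (\<Union>j\<in>{1..M}. B j)"
      using finR finB by (intro sum.union_disjoint) (auto simp: core)
    finally show ?thesis .
  qed
  also have "sum w (\<Union>j\<in>{1..M}. B j) \<le> (\<Sum>j\<in>{1..M}. sum w (B j))"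
  proof -
    have "sum w (\<Union>j\<in>J. B j) \<le> (\<Sum>j\<in>J. sum w (B j))" if "finite J" "J \<subseteq> {1..M}" for J
      using that
    proof (induction J rule: finite_induct)
      case (insert j J)
      have "finite (\<Union>j\<in>J. B j)"
        using insert finB by auto
      then have "sum w (\<Union>j\<in>insert j J. B j) = sum w (B j) + sum w (\<Union>j\<in>J. B j)
          - sum w (B j \<inter> (\<Union>j\<in>J. B j))"
        using insert.prems finB by (simp add: sum_Un)
      moreover have "B j \<subseteq> S"
        using insert.prems by (intro BS) auto
      then have "0 \<le> sum w (B j \<inter> (\<Union>j\<in>J. B j))"
        using nonneg by (intro sum_nonneg) auto
      ultimately show ?case
        using insert by simp
    qed simp
    from this[of "{1..M}"] show ?thesis by simp
  qed
  finally show ?thesis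
    by (simp add: B_def rel_eq[OF assms])
qed

text \<open>The greedy analysis uses the components only through the exchange inequality
  \<open>exch\<close>, which growth systems and matroids both satisfy; their bounds on blocked
  weight enter separately.\<close>

context
  fixes \<kappa> :: "nat \<Rightarrow> nat" and k :: nat
  assumes exch: "\<And>j I G. j \<in> {1..M} \<Longrightarrow> I \<in> Ij j \<Longrightarrow> G \<in> Ij j \<Longrightarrow>
      (\<And>e. e \<in> I - G \<Longrightarrow> insert e G \<notin> Ij j) \<Longrightarrow> card (I - G) \<le> \<kappa> j * card (G - I)"
    and k: "\<And>e. e \<in> S \<Longrightarrow> (\<Sum>j | j \<in> {1..M} \<and> e \<in> Sj j. \<kappa> j) \<le> k"
    and k_pos: "0 < k"
begin

text \<open>Each \<open>e\<close> in \<open>I - G\<close> is refused by some component containing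
  it. The local exchange inequalities charge the refusals of component \<open>j\<close> to
  \<open>(G - I) \<inter> Sj j\<close>, and each element of \<open>G - I\<close> is charged at most
  \<open>k\<close> times in total.\<close>

lemma comb_exchange:
  assumes I: "I \<in> \<F>" and G: "G \<in> \<F>" and max: "\<And>e. e \<in> I - G \<Longrightarrow> insert e G \<notin> \<F>"
  shows "card (I - G) \<le> k * card (G - I)"
proof -
  define A where "A j = {e \<in> I \<inter> Sj j - G. insert e (G \<inter> Sj j) \<notin> Ij j}" for j
  have IS: "I \<subseteq> S" "finite I" "G \<subseteq> S" "finite G"
    using indep_systemD(2,5)[OF sys] I G by auto
  have "I - G \<subseteq> (\<Union>j\<in>{1..M}. A j)"
  proof
    fix e assume e: "e \<in> I - G"
    then obtain j where j: "j \<in> {1..M}" "insert e G \<inter> Sj j \<notin> Ij j"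
      using max[OF e] IS by (auto simp: comb_indep_iff)
    moreover have "G \<inter> Sj j \<in> Ij j"
      using G j by (simp add: comb_indep_iff)
    ultimately have "e \<in> Sj j"
      by (metis Int_insert_left)
    then show "e \<in> (\<Union>j\<in>{1..M}. A j)"
      using e j by (auto simp: A_def)
  qed
  then have "card (I - G) \<le> card (\<Union>j\<in>{1..M}. A j)"
    using IS by (intro card_mono) (auto simp: A_def)
  also have "\<dots> \<le> (\<Sum>j\<in>{1..M}. card (A j))"
    by (rule card_UN_le) simp
  also have "\<dots> \<le> (\<Sum>j\<in>{1..M}. \<kappa> j * card ((G - I) \<inter> Sj j))"
  proof (rule sum_mono)
    fix j assume j: "j \<in> {1..M}"
    \<comment> \<open>The elements of \<open>I - G\<close> are cut down to \<open>A j\<close> so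
      that none extends \<open>?G\<close>; keeping the common part makes \<open>?G - ?I\<close>
      avoid all of \<open>I\<close>.\<close>
    let ?I = "I \<inter> G \<inter> Sj j \<union> A j" and ?G = "G \<inter> Sj j"
    have "card (?I - ?G) \<le> \<kappa> j * card (?G - ?I)"
    proof (rule exch[OF j])
      have "I \<inter> Sj j \<in> Ij j"
        using I j by (simp add: comb_indep_iff)
      then show "?I \<in> Ij j"
        by (rule indep_systemD(3)[OF comp[OF j]]) (auto simp: A_def)
      show "?G \<in> Ij j"
        using G j by (simp add: comb_indep_iff)
    qed (auto simp: A_def)
    moreover have "?I - ?G = A j" "?G - ?I = (G - I) \<inter> Sj j"
      by (auto simp: A_def)
    ultimately show "card (A j) \<le> \<kappa> j * card ((G - I) \<inter> Sj j)"
      by simp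
  qed
  finally have "real (card (I - G)) \<le> (\<Sum>j\<in>{1..M}. real (\<kappa> j) * sum (\<lambda>_. 1) ((G - I) \<inter> Sj j))"
    by (simp flip: of_nat_mult of_nat_sum)
  also have "\<dots> \<le> real k * sum (\<lambda>_. 1) (G - I)"
    using IS k by (intro weighted_sum_components_le) auto
  finally show ?thesis
    by (simp flip: of_nat_mult)
qed

text \<open>No element of a level of \<open>I\<close> outside the greedy set extends the same level
  of the greedy set, so the exchange inequality applies level by level.\<close>

lemma greedy_weight_ge:
  assumes X: "X \<subseteq> S" and I: "I \<in> \<F>" "I \<subseteq> X"
  shows "sum w I \<le> real k * sum w (greedy w \<F> X)"
proof (rule sum_le_if_card_levels_le)
  have G: "greedy w \<F> X \<in> \<F>" "greedy w \<F> X \<subseteq> S"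
    using greedy_indep[OF X] indep_systemD(2)[OF sys] by auto
  show fin: "finite I" "finite (greedy w \<F> X)"
    using indep_systemD(5)[OF sys] I G by auto
  show "0 \<le> w e" if "e \<in> I \<union> greedy w \<F> X" for e
    using that I X G nonneg by blast
  fix t
  let ?I = "{e \<in> I. t \<le> w e}" and ?G = "{e \<in> greedy w \<F> X. t \<le> w e}"
  have outside: "card (?I - ?G) \<le> k * card (?G - ?I)"
  proof (rule comb_exchange)
    show "?I \<in> \<F>"
      by (rule indep_systemD(3)[OF sys I(1)]) auto
    show "?G \<in> \<F>"
      by (rule indep_systemD(3)[OF sys G(1)]) auto
    show "insert e ?G \<notin> \<F>" if "e \<in> ?I - ?G" for e
      using that I(2) by (intro greedy_level_maximal[OF X]) auto
  qed
  have I_split: "card ?I = card (?I \<inter> ?G) + card (?I - ?G)"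
    using fin by (simp add: card_Int_Diff)
  have G_split: "card ?G = card (?I \<inter> ?G) + card (?G - ?I)"
    using fin card_Int_Diff[of ?G ?I] by (simp add: Int_commute[of ?I ?G])
  \<comment> \<open>The exchange inequality compares only the two differences; for the common
    elements \<open>k \<ge> 1\<close> is used.\<close>
  have inside: "card (?I \<inter> ?G) \<le> k * card (?I \<inter> ?G)"
    using k_pos by simp
  show "card ?I \<le> k * card ?G"
    unfolding I_split G_split add_mult_distrib2 by (rule add_mono[OF inside outside])
qed

text \<open>Let \<open>A\<close> be the sum of \<open>w e * x e\<close>. Greedy on \<open>Y\<close>
  gives \<open>sum w OPT \<le> k * A\<close>, \<open>Rel Y\<close> has expected weight
  \<open>(1 - p) * A\<close>, and the components discard at most a fraction \<open>k * r\<close> of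
  it. Growth systems take \<open>r = (1 - p) / p\<close>, matroids \<open>r = 1 - p\<close>.\<close>

lemma expected_core_weight_ge:
  fixes p r :: real
  assumes p: "0 < p" "p \<le> 1" and r: "0 \<le> r" "real k * r \<le> 1" and OPT: "OPT \<in> \<F>"
    and blocked: "\<And>j. j \<in> {1..M} \<Longrightarrow>
      (\<Sum>e\<in>Sj j. w e * measure_pmf.expectation (random_subset S p) (\<lambda>Y. of_bool (blocked j Y e)))
      \<le> r * real (\<kappa> j) *
        (\<Sum>e\<in>Sj j. w e * measure_pmf.expectation (random_subset S p) (\<lambda>Y. of_bool (candidate w \<F> Y e)))"
  shows "(1 - p) * (1 - real k * r) / real k * sum w OPT \<le> expected_core_weight w M Sj Ij p"
proof -
  let ?E = "measure_pmf.expectation (random_subset S p)"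
  define x where "x e = ?E (\<lambda>Y. of_bool (candidate w \<F> Y e) :: real)" for e
  define b where "b j e = ?E (\<lambda>Y. of_bool (blocked j Y e) :: real)" for j e
  have p0: "0 \<le> p"
    using p by simp
  have OPT_S: "OPT \<subseteq> S"
    by (rule indep_systemD(2)[OF sys OPT])
  have wx: "0 \<le> w e * x e" if "e \<in> S" for e
    using nonneg[OF that] by (auto simp: x_def intro!: mult_nonneg_nonneg Bochner_Integration.integral_nonneg)

  have "p * sum w OPT = ?E (\<lambda>Y. sum w {e \<in> OPT \<inter> Y. True})"
    using expectation_weight_random_subset(1)[OF finite_ground OPT_S p0 p(2), of "\<lambda>_ _. True"] by simp
  also have "\<dots> \<le> ?E (\<lambda>Y. real k * sum w {e \<in> S \<inter> Y. candidate w \<F> Y e})"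
  proof (rule expectation_random_subset_mono[OF finite_ground])
    fix Y assume Y: "Y \<subseteq> S"
    have "sum w (OPT \<inter> Y) \<le> real k * sum w (greedy w \<F> Y)"
      by (rule greedy_weight_ge[OF Y indep_systemD(3)[OF sys OPT]]) auto
    moreover have "greedy w \<F> Y = {e \<in> S \<inter> Y. candidate w \<F> Y e}"
      using Y by (auto simp: greedy_eq)
    ultimately show "sum w {e \<in> OPT \<inter> Y. True} \<le> real k * sum w {e \<in> S \<inter> Y. candidate w \<F> Y e}"
      by (simp add: Int_def)
  qed
  also have "\<dots> = real k * ?E (\<lambda>Y. sum w {e \<in> S \<inter> Y. candidate w \<F> Y e})"
    by simp
  also have "?E (\<lambda>Y. sum w {e \<in> S \<inter> Y. candidate w \<F> Y e}) = p * (\<Sum>e\<in>S. w e * x e)"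
    unfolding x_def
    by (rule expectation_weight_random_subset(1)[OF finite_ground order_refl p0 p(2)])
      (simp add: candidate_insert_self)
  \<comment> \<open>Sampling \<open>OPT\<close> and sampling the candidates both contribute a factor
    \<open>p\<close>, which cancels because \<open>p > 0\<close>.\<close>
  finally have opt: "sum w OPT \<le> real k * (\<Sum>e\<in>S. w e * x e)"
    using p by (simp add: mult.left_commute)

  have "(\<Sum>j\<in>{1..M}. \<Sum>e\<in>Sj j. w e * b j e)
      \<le> (\<Sum>j\<in>{1..M}. r * (real (\<kappa> j) * (\<Sum>e\<in>S \<inter> Sj j. w e * x e)))"
  proof (rule sum_mono)
    fix j assume j: "j \<in> {1..M}"
    then show "(\<Sum>e\<in>Sj j. w e * b j e) \<le> r * (real (\<kappa> j) * (\<Sum>e\<in>S \<inter> Sj j. w e * x e))"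
      using blocked[OF j] component_subset[OF j] by (simp add: b_def x_def Int_absorb1 mult.assoc)
  qed
  also have "\<dots> \<le> r * (real k * (\<Sum>e\<in>S. w e * x e))"
    unfolding sum_distrib_left[symmetric]
    using finite_ground wx k r(1) by (intro mult_left_mono weighted_sum_components_le) auto
  finally have discarded: "(\<Sum>j\<in>{1..M}. \<Sum>e\<in>Sj j. w e * b j e) \<le> r * (real k * (\<Sum>e\<in>S. w e * x e))" .

  \<comment> \<open>\<open>real k * r \<le> 1\<close> and \<open>p \<le> 1\<close> make the
    coefficient nonnegative, so \<open>sum w OPT\<close> may be replaced by its upper bound.\<close>
  have "(1 - p) * (1 - real k * r) / real k * sum w OPT
      \<le> (1 - p) * (1 - real k * r) / real k * (real k * (\<Sum>e\<in>S. w e * x e))"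
    using opt p r by (intro mult_left_mono) auto
  also have "\<dots> = (1 - p) * (1 - real k * r) * (\<Sum>e\<in>S. w e * x e)"
    using k_pos by simp
  also have "\<dots> = (1 - p) * ((\<Sum>e\<in>S. w e * x e) - r * (real k * (\<Sum>e\<in>S. w e * x e)))"
    by (simp add: algebra_simps)
  also have "\<dots> \<le> (1 - p) * ((\<Sum>e\<in>S. w e * x e) - (\<Sum>j\<in>{1..M}. \<Sum>e\<in>Sj j. w e * b j e))"
    using discarded p by (intro mult_left_mono) auto
  also have "\<dots> = (1 - p) * (\<Sum>e\<in>S. w e * x e) - (\<Sum>j\<in>{1..M}. (1 - p) * (\<Sum>e\<in>Sj j. w e * b j e))"
    by (simp add: right_diff_distrib sum_distrib_left)
  also have "(1 - p) * (\<Sum>e\<in>S. w e * x e) = ?E (\<lambda>Y. sum w {e \<in> S - Y. candidate w \<F> Y e})"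
    unfolding x_def
    by (rule expectation_weight_random_subset(2)[OF finite_ground order_refl p0 p(2), symmetric])
      (simp add: candidate_insert_self)
  also have "(\<Sum>j\<in>{1..M}. (1 - p) * (\<Sum>e\<in>Sj j. w e * b j e))
      = (\<Sum>j\<in>{1..M}. ?E (\<lambda>Y. sum w {e \<in> Sj j - Y. blocked j Y e}))"
  proof (rule sum.cong[OF refl])
    fix j assume "j \<in> {1..M}"
    note j = component_subset[OF this]
    show "(1 - p) * (\<Sum>e\<in>Sj j. w e * b j e) = ?E (\<lambda>Y. sum w {e \<in> Sj j - Y. blocked j Y e})"
      unfolding b_def
      by (rule expectation_weight_random_subset(2)[OF finite_ground j p0 p(2), symmetric])
        (rule blocked_insert_self; use j in auto)
  qed
  also have "?E (\<lambda>Y. sum w {e \<in> S - Y. candidate w \<F> Y e}) - \<dots>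
      = ?E (\<lambda>Y. sum w {e \<in> S - Y. candidate w \<F> Y e} - (\<Sum>j\<in>{1..M}. sum w {e \<in> Sj j - Y. blocked j Y e}))"
    using integrable_random_subset[OF finite_ground]
    by simp
  also have "\<dots> \<le> expected_core_weight w M Sj Ij p"
    unfolding expected_core_weight_def
    by (rule expectation_random_subset_mono[OF finite_ground weight_core_Rel_ge])
  finally show ?thesis .
qed

end

text \<open>The sampled blocked elements weigh at most \<open>c\<close> times
  \<open>Rel Y \<inter> Sj j\<close>, which avoids \<open>Y\<close>. In expectation this reads
  \<open>p * ?b \<le> c * (1 - p) * ?x\<close>.\<close>

lemma growth_blocked_le:
  assumes j: "j \<in> {1..M}" and gs: "growth_system c (Sj j) (Ij j)" and p: "0 < p" "p \<le> 1"
  shows "(\<Sum>e\<in>Sj j. w e * measure_pmf.expectation (random_subset S p) (\<lambda>Y. of_bool (blocked j Y e)))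
    \<le> (1 - p) / p * real c *
      (\<Sum>e\<in>Sj j. w e * measure_pmf.expectation (random_subset S p) (\<lambda>Y. of_bool (candidate w \<F> Y e)))"
    (is "?b \<le> _ * ?x")
proof -
  let ?E = "measure_pmf.expectation (random_subset S p)"
  have p0: "0 \<le> p"
    using p by simp
  note jS = component_subset[OF j]
  have "p * ?b = ?E (\<lambda>Y. sum w {e \<in> Sj j \<inter> Y. blocked j Y e})"
    by (rule expectation_weight_random_subset(1)[OF finite_ground jS p0 p(2), symmetric])
      (rule blocked_insert_self; use jS in auto)
  also have "\<dots> \<le> ?E (\<lambda>Y. real c * sum w {e \<in> Sj j - Y. candidate w \<F> Y e})"
  proof (rule expectation_random_subset_mono[OF finite_ground])
    fix Y assume Y: "Y \<subseteq> S"
    have "sum w {e \<in> Sj j \<inter> Y. blocked j Y e} \<le> real c * sum w (Rel Y \<inter> Sj j)"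
    proof (rule growth_weight_hull_le[OF gs blocked_sample_indep[OF j Y]])
      show "{e \<in> Sj j \<inter> Y. blocked j Y e} \<inter> (Rel Y \<inter> Sj j) = {}"
        by (auto simp: rel_def)
      show "0 \<le> w e" if "e \<in> Sj j" for e
        using that nonneg jS by auto
    qed (auto simp: blocked_def)
    then show "sum w {e \<in> Sj j \<inter> Y. blocked j Y e} \<le> real c * sum w {e \<in> Sj j - Y. candidate w \<F> Y e}"
      by (simp add: Rel_component[OF j Y])
  qed
  also have "\<dots> = real c * ?E (\<lambda>Y. sum w {e \<in> Sj j - Y. candidate w \<F> Y e})"
    by simp
  also have "?E (\<lambda>Y. sum w {e \<in> Sj j - Y. candidate w \<F> Y e}) = (1 - p) * ?x"
    by (rule expectation_weight_random_subset(2)[OF finite_ground jS p0 p(2)])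
      (simp add: candidate_insert_self)
  finally show ?thesis
    using p by (simp add: field_simps)
qed

text \<open>The sampled blocked elements weigh at most the primitive core, that is
  \<open>Rel Y \<inter> Sj j\<close> minus its discarded part. In expectation
  \<open>p * ?b \<le> (1 - p) * ?x - (1 - p) * ?b\<close>, and the two multiples of
  \<open>?b\<close> add up to \<open>?b\<close>.\<close>

lemma matroid_blocked_le:
  assumes j: "j \<in> {1..M}" and mat: "matroid (Sj j) (Ij j)" and p: "0 \<le> p" "p \<le> 1"
  shows "(\<Sum>e\<in>Sj j. w e * measure_pmf.expectation (random_subset S p) (\<lambda>Y. of_bool (blocked j Y e)))
    \<le> (1 - p) *
      (\<Sum>e\<in>Sj j. w e * measure_pmf.expectation (random_subset S p) (\<lambda>Y. of_bool (candidate w \<F> Y e)))"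
    (is "?b \<le> _ * ?x")
proof -
  let ?E = "measure_pmf.expectation (random_subset S p)"
  note jS = component_subset[OF j]
  have finj: "finite (Sj j)"
    by (rule finite_subset[OF jS finite_ground])
  have "p * ?b = ?E (\<lambda>Y. sum w {e \<in> Sj j \<inter> Y. blocked j Y e})"
    by (rule expectation_weight_random_subset(1)[OF finite_ground jS p, symmetric])
      (rule blocked_insert_self; use jS in auto)
  also have "\<dots> \<le> ?E (\<lambda>Y. sum w {e \<in> Sj j - Y. candidate w \<F> Y e} - sum w {e \<in> Sj j - Y. blocked j Y e})"
  proof (rule expectation_random_subset_mono[OF finite_ground])
    fix Y assume Y: "Y \<subseteq> S"
    let ?N = "Rel Y \<inter> Sj j"
    have core: "primitive_core w (Sj j) (Ij j) ?N \<subseteq> ?N"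
      by (rule primitive_core_subset)
    have "sum w {e \<in> Sj j \<inter> Y. blocked j Y e} \<le> sum w (primitive_core w (Sj j) (Ij j) ?N)"
    proof (rule matroid_weight_hull_le[OF mat blocked_sample_indep[OF j Y]])
      show "inj_on w (Sj j)"
        by (rule inj_on_subset[OF w_inj jS])
      show "0 \<le> w e" if "e \<in> Sj j" for e
        using that nonneg jS by auto
    qed (auto simp: blocked_def)
    also have "\<dots> = sum w ?N - sum w (?N - primitive_core w (Sj j) (Ij j) ?N)"
      using sum.subset_diff[OF core, of w] finj by simp
    also have "?N - primitive_core w (Sj j) (Ij j) ?N = {e \<in> Sj j - Y. blocked j Y e}"
      by (rule blocked_eq_discarded[OF j Y, symmetric])
    also have "?N = {e \<in> Sj j - Y. candidate w \<F> Y e}"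
      by (rule Rel_component[OF j Y])
    finally show "sum w {e \<in> Sj j \<inter> Y. blocked j Y e}
        \<le> sum w {e \<in> Sj j - Y. candidate w \<F> Y e} - sum w {e \<in> Sj j - Y. blocked j Y e}" .
  qed
  also have "\<dots> = ?E (\<lambda>Y. sum w {e \<in> Sj j - Y. candidate w \<F> Y e})
      - ?E (\<lambda>Y. sum w {e \<in> Sj j - Y. blocked j Y e})"
    by (intro Bochner_Integration.integral_diff integrable_random_subset finite_ground)
  also have "?E (\<lambda>Y. sum w {e \<in> Sj j - Y. candidate w \<F> Y e}) = (1 - p) * ?x"
    by (rule expectation_weight_random_subset(2)[OF finite_ground jS p])
      (simp add: candidate_insert_self)
  also have "?E (\<lambda>Y. sum w {e \<in> Sj j - Y. blocked j Y e}) = (1 - p) * ?b"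
    by (rule expectation_weight_random_subset(2)[OF finite_ground jS p])
      (rule blocked_insert_self; use jS in auto)
  finally show ?thesis
    by (simp add: algebra_simps)
qed

section \<open>The parameter \<open>k\<close> and the case of disjoint matroids\<close>

lemma comb_param_ge:
  assumes "e \<in> S"
  shows "(\<Sum>j | j \<in> {1..M} \<and> e \<in> Sj j. \<kappa> j) \<le> comb_param M Sj \<kappa>"
  unfolding comb_param_def using assms finite_ground by (intro Max_ge) auto

lemma comb_param_pos:
  assumes "\<And>j. j \<in> {1..M} \<Longrightarrow> 0 < \<kappa> j"
  shows "0 < comb_param M Sj \<kappa>"
proof -
  obtain e where e: "e \<in> S"
    using nonempty by blast
  then obtain j where j: "j \<in> {1..M}" "e \<in> Sj j"
    by (auto simp: comb_ground_def)
  have "\<kappa> j \<le> (\<Sum>j | j \<in> {1..M} \<and> e \<in> Sj j. \<kappa> j)"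
    using j by (intro member_le_sum) auto
  also have "\<dots> \<le> comb_param M Sj \<kappa>"
    by (rule comb_param_ge[OF e])
  finally show ?thesis
    using assms[OF j(1)] by simp
qed

lemma random_subset_0: "random_subset S 0 = return_pmf {}"
proof -
  have "bernoulli_pmf 0 = return_pmf False"
  proof (rule pmf_eqI)
    show "pmf (bernoulli_pmf 0) b = pmf (return_pmf False) b" for b
      by (cases b) simp_all
  qed
  then show ?thesis
    using finite_ground by (simp add: random_subset_def)
qed

text \<open>At \<open>p = 0\<close> the sample is empty and \<open>Rel {}\<close> contains
  \<open>OPT\<close>. Since the components are disjoint, \<open>OPT\<close> can be compared with the
  primitive core in each of them separately.\<close>

lemma matroid_expected_core_weight_ge:
  assumes mat: "\<And>j. j \<in> {1..M} \<Longrightarrow> matroid (Sj j) (Ij j)"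
    and k: "comb_param M Sj (\<lambda>_. 1) = 1" and OPT: "OPT \<in> \<F>"
  shows "sum w OPT \<le> expected_core_weight w M Sj Ij 0"
proof -
  let ?C = "\<lambda>j. primitive_core w (Sj j) (Ij j) (Rel {} \<inter> Sj j)"
  have OPT_S: "OPT \<subseteq> S"
    by (rule indep_systemD(2)[OF sys OPT])
  have finj: "finite (Sj j)" if "j \<in> {1..M}" for j
    by (rule finite_subset[OF component_subset[OF that] finite_ground])
  have unique: "i = j" if "i \<in> {1..M}" "j \<in> {1..M}" "e \<in> Sj i" "e \<in> Sj j" for i j e
  proof -
    have "e \<in> S"
      using component_subset[OF that(1)] that by auto
    \<comment> \<open>With all parameters equal to 1, the sum bounded by \<open>comb_param\<close>
      counts the components containing \<open>e\<close>.\<close>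
    then have "card {j. j \<in> {1..M} \<and> e \<in> Sj j} \<le> 1"
      using comb_param_ge[of e "\<lambda>_. 1"] k by simp
    then show ?thesis
      using that card_le_Suc0_iff_eq[of "{j. j \<in> {1..M} \<and> e \<in> Sj j}"] by auto
  qed
  have C_sub: "?C j \<subseteq> Rel {} \<inter> Sj j" for j
    by (rule primitive_core_subset)
  have finC: "finite (?C j)" if "j \<in> {1..M}" for j
    using finite_subset[OF C_sub] finj[OF that] by simp
  have "candidate w \<F> {} e" if "e \<in> OPT" for e
  proof -
    have "greedy w \<F> {} = {}"
      by (simp add: greedy_eq)
    moreover have "{e} \<in> \<F>"
      by (rule indep_systemD(3)[OF sys OPT]) (use that in simp)
    ultimately show ?thesis
      by (simp add: candidate_def)
  qed
  then have OPT_Rel: "OPT \<subseteq> Rel {}"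
    using OPT_S by (auto simp: rel_eq)
  have "OPT = (\<Union>j\<in>{1..M}. OPT \<inter> Sj j)"
    using OPT_S by (auto simp: comb_ground_def)
  then have "sum w OPT = sum w (\<Union>j\<in>{1..M}. OPT \<inter> Sj j)"
    by simp
  also have "\<dots> = (\<Sum>j\<in>{1..M}. sum w (OPT \<inter> Sj j))"
    using finj unique by (intro sum.UNION_disjoint) (simp, simp, blast)
  also have "\<dots> \<le> (\<Sum>j\<in>{1..M}. sum w (?C j))"
  proof (rule sum_mono)
    fix j assume j: "j \<in> {1..M}"
    note jS = component_subset[OF j]
    show "sum w (OPT \<inter> Sj j) \<le> sum w (?C j)"
    proof (rule matroid_weight_hull_le[OF mat[OF j]])
      show "OPT \<inter> Sj j \<in> Ij j"
        using OPT j by (simp add: comb_indep_iff)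
      show "inj_on w (Sj j)"
        by (rule inj_on_subset[OF w_inj jS])
      show "0 \<le> w e" if "e \<in> Sj j" for e
        using that nonneg jS by auto
    qed (use OPT_Rel in auto)
  qed
  also have "\<dots> = sum w (\<Union>j\<in>{1..M}. ?C j)"
    using finC C_sub unique by (intro sum.UNION_disjoint[symmetric]) (simp, simp, blast)
  \<comment> \<open>Every element lies in exactly one component, so surviving there means surviving
    in the core.\<close>
  also have "(\<Union>j\<in>{1..M}. ?C j) = core w M Sj Ij (Rel {})"
  proof
    show "(\<Union>j\<in>{1..M}. ?C j) \<subseteq> core w M Sj Ij (Rel {})"
    proof
      fix e assume "e \<in> (\<Union>j\<in>{1..M}. ?C j)"
      then obtain j where j: "j \<in> {1..M}" "e \<in> ?C j" by blast
      then have "e \<in> Rel {}" "e \<in> Sj j"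
        using C_sub[of j] by auto
      moreover have "e \<in> ?C i" if "i \<in> {1..M}" "e \<in> Sj i" for i
        using unique[OF that(1) j(1) that(2) \<open>e \<in> Sj j\<close>] j by simp
      ultimately show "e \<in> core w M Sj Ij (Rel {})"
        by (simp add: core_eq[OF Rel_subset])
    qed
    show "core w M Sj Ij (Rel {}) \<subseteq> (\<Union>j\<in>{1..M}. ?C j)"
      using Rel_subset[of "{}"] unfolding core_eq[OF Rel_subset] by (auto simp: comb_ground_def)
  qed
  finally show ?thesis
    by (simp add: expected_core_weight_def random_subset_0)
qed

end

section \<open>The approximation guarantees\<close>

lemma sqrt_one_plus_less:
  fixes u :: real
  assumes "0 < u" "u \<le> 1"
  shows "2 * sqrt (1 + u) < 2 + u - u\<^sup>2 / 4 + u ^ 3 / 8"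
proof -
  \<comment> \<open>The third-order Taylor polynomial of \<open>sqrt (1 + u)\<close> at 0. Its
    square exceeds \<open>1 + u\<close> by terms of order at least 4, with positive sum for
    \<open>u \<le> 1\<close>.\<close>
  define s where "s = 1 + u / 2 - u\<^sup>2 / 8 + u ^ 3 / 16"
  have "u\<^sup>2 \<le> u" "0 < u ^ 3" "0 < u ^ 4" "0 < u ^ 6"
    using assms by (simp_all add: power2_eq_square mult_left_le)
  then have "0 \<le> s"
    using assms unfolding s_def by linarith
  have "s\<^sup>2 = 1 + u + (5 / 64 * u ^ 4 - u ^ 5 / 64 + u ^ 6 / 256)"
    unfolding s_def by (simp add: power2_eq_square algebra_simps eval_nat_numeral)
  moreover have "u ^ 5 \<le> u ^ 4"
    using assms by (intro power_decreasing) auto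
  ultimately have "1 + u < s\<^sup>2"
    using \<open>0 < u ^ 4\<close> \<open>0 < u ^ 6\<close> by linarith
  then have "sqrt (1 + u) < s"
    using \<open>0 \<le> s\<close> assms by (intro real_less_lsqrt) auto
  then show ?thesis
    by (simp add: s_def)
qed

theorem theorem4:
  fixes M :: nat
    and Sj :: "nat \<Rightarrow> 'a set"
    and Ij :: "nat \<Rightarrow> 'a set set"
    and w :: "'a \<Rightarrow> real"
    and OPT :: "'a set"
  assumes "\<And>j. j \<in> {1..M} \<Longrightarrow> indep_system (Sj j) (Ij j)"
    and "comb_ground M Sj \<noteq> {}"
    and "\<And>e. e \<in> comb_ground M Sj \<Longrightarrow> 0 \<le> w e"
    and "inj_on w (comb_ground M Sj)"
    and "max_weight_indep w (comb_indep M Sj Ij) OPT"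
  shows "(\<forall>\<kappa> k. (\<forall>j\<in>{1..M}. growth_system (\<kappa> j) (Sj j) (Ij j)) \<and> k = comb_param M Sj \<kappa> \<longrightarrow>
           expected_core_weight w M Sj Ij (sqrt (1 - 1 / (real k + 1)))
             \<ge> (2 + 1 / real k - 2 * sqrt (1 + 1 / real k)) * sum w OPT \<and>
           2 + 1 / real k - 2 * sqrt (1 + 1 / real k) > 1 / (4 * real k ^ 2) - 1 / (8 * real k ^ 3)) \<and>
         (\<forall>k. (\<forall>j\<in>{1..M}. matroid (Sj j) (Ij j)) \<and> k = comb_param M Sj (\<lambda>_. 1) \<longrightarrow>
           (k = 1 \<longrightarrow> expected_core_weight w M Sj Ij 0 \<ge> sum w OPT) \<and>
           (k \<ge> 2 \<longrightarrow> expected_core_weight w M Sj Ij (1 - 1 / (2 * real k))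
                        \<ge> 1 / (4 * real k ^ 2) * sum w OPT))"
proof -
  interpret combined_system M Sj Ij w
    by unfold_locales (fact assms)+
  have OPT: "OPT \<in> \<F>"
    using assms(5) by (simp add: max_weight_indep_def is_arg_max_def)
  show ?thesis
  proof (intro conjI allI impI; elim conjE)
    fix \<kappa> k
    assume gs: "\<forall>j\<in>{1..M}. growth_system (\<kappa> j) (Sj j) (Ij j)" and k: "k = comb_param M Sj \<kappa>"
    then have k_pos: "0 < k"
      by (auto simp: growth_system_def intro: comb_param_pos)
    \<comment> \<open>This \<open>p\<close> maximizes \<open>(1 - p) * (1 / k - (1 - p) / p) = 2 + 1
      / k - p * (1 + 1 / k) - 1 / p\<close>; at the maximum the last two terms are equal.\<close>
    define p where "p = sqrt (1 - 1 / (real k + 1))"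
    have p2: "p\<^sup>2 = real k / (real k + 1)"
      using k_pos by (simp add: p_def field_simps)
    have p: "0 < p" "p < 1"
      using k_pos by (simp_all add: p_def field_simps)
    have k_eq: "1 / real k = 1 / p\<^sup>2 - 1"
      using k_pos p by (simp add: p2 field_simps)
    \<comment> \<open>The condition \<open>k * r \<le> 1\<close> for \<open>r = (1 - p) / p\<close>;
      it follows from \<open>p\<^sup>2 \<le> p\<close>.\<close>
    have "real k * (1 - p) \<le> p"
    proof -
      have "real k = p\<^sup>2 * (real k + 1)"
        using p2 k_pos by simp
      also have "\<dots> \<le> p * (real k + 1)"
        using p by (intro mult_right_mono) (simp_all add: power2_eq_square)
      finally show ?thesis
        by (simp add: algebra_simps)
    qed
    then have r: "0 \<le> (1 - p) / p" "real k * ((1 - p) / p) \<le> 1"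
      using p by (simp_all add: field_simps)
    have "(1 - p) * (1 - real k * ((1 - p) / p)) / real k * sum w OPT \<le> expected_core_weight w M Sj Ij p"
    proof (rule expected_core_weight_ge[where \<kappa> = \<kappa>])
      show "card (I - G) \<le> \<kappa> j * card (G - I)"
        if "j \<in> {1..M}" "I \<in> Ij j" "G \<in> Ij j" "\<And>e. e \<in> I - G \<Longrightarrow> insert e G \<notin> Ij j" for j I G
        using growth_exchange[of "\<kappa> j" "Sj j" "Ij j" I G] gs that by blast
    qed (use p k_pos k comb_param_ge r OPT gs growth_blocked_le in auto)
    also have "(1 - p) * (1 - real k * ((1 - p) / p)) / real k = (1 - p) * (1 / real k - (1 - p) / p)"
      using k_pos p by (simp add: field_simps)
    also have "\<dots> = 2 + 1 / real k - 2 * (1 / p)"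
      unfolding k_eq using p by (simp add: field_simps power2_eq_square)
    also have "1 / p = sqrt (1 + 1 / real k)"
    proof -
      have "sqrt (1 + 1 / real k) = sqrt ((1 / p)\<^sup>2)"
        by (simp add: k_eq power_divide)
      then show ?thesis
        using p by simp
    qed
    finally show "(2 + 1 / real k - 2 * sqrt (1 + 1 / real k)) * sum w OPT
        \<le> expected_core_weight w M Sj Ij (sqrt (1 - 1 / (real k + 1)))"
      by (simp add: p_def)
    show "1 / (4 * real k ^ 2) - 1 / (8 * real k ^ 3) < 2 + 1 / real k - 2 * sqrt (1 + 1 / real k)"
      using sqrt_one_plus_less[of "1 / real k"] k_pos by (simp add: power_divide)
  next
    fix k
    assume mat: "\<forall>j\<in>{1..M}. matroid (Sj j) (Ij j)" and k: "k = comb_param M Sj (\<lambda>_. 1)"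
    show "sum w OPT \<le> expected_core_weight w M Sj Ij 0" if "k = 1"
      using matroid_expected_core_weight_ge[OF _ _ OPT] mat k that by simp
    show "1 / (4 * real k ^ 2) * sum w OPT \<le> expected_core_weight w M Sj Ij (1 - 1 / (2 * real k))"
      if "2 \<le> k"
    proof -
      \<comment> \<open>With \<open>q = 1 - p\<close> the bound is \<open>q * (1 / k - q)\<close>,
        which is largest at \<open>q = 1 / (2 * k)\<close>.\<close>
      define p where "p = 1 - 1 / (2 * real k)"
      have p: "0 < p" "p \<le> 1" and r: "0 \<le> 1 - p" "real k * (1 - p) \<le> 1"
        using that by (simp_all add: p_def field_simps)
      have "(1 - p) * (1 - real k * (1 - p)) / real k * sum w OPT \<le> expected_core_weight w M Sj Ij p"
      proof (rule expected_core_weight_ge[where \<kappa> = "\<lambda>_. 1"])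
        show "card (I - G) \<le> 1 * card (G - I)"
          if "j \<in> {1..M}" "I \<in> Ij j" "G \<in> Ij j" "\<And>e. e \<in> I - G \<Longrightarrow> insert e G \<notin> Ij j" for j I G
          using matroid_exchange[of "Sj j" "Ij j" I G] mat that by simp
        show "(\<Sum>j | j \<in> {1..M} \<and> e \<in> Sj j. 1) \<le> k" if "e \<in> S" for e
          using comb_param_ge[OF that, of "\<lambda>_. 1"] k by simp
      qed (use p that r OPT mat matroid_blocked_le in auto)
      also have "(1 - p) * (1 - real k * (1 - p)) / real k = 1 / (4 * real k ^ 2)"
        using that by (simp add: p_def field_simps power2_eq_square)
      finally show ?thesis
        by (simp add: p_def)
    qed
  qed
qed

end
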